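(* Let $R$ be a division ring and let $Q=Q_1*_RQ_2$ be the amalgamated product of two quadratic extensions $Q_1$, $Q_2$ of $R$ with associated data $(\tau_1,\delta_1)$ and $(\tau_2,\delta_2)$. If $\tau_1$ and $\tau_2$ are automorphisms of $R$, $\delta_1$ is not an inner $\tau_1$-derivation, and $\delta_2$ is not an inner $\tau_2$-derivation, then $Q$ is a principal ideal ring.
   Context: Rings are associative and unital. A principal ideal ring here means a ring in which every two-sided ideal is generated, as a two-sided ideal, by a single element. An extension of rings $R\subseteq A$ is quadratic if there is $x\in A\setminus R$ such that $A$ is a free left $R$-module with basis $\{1,x\}$; then there are a ring endomorphism $\tau$ of $R$, a left $\tau$-derivation $\delta$ of $R$ (a $\mathbb{Z}$-linear map with $\delta(rs)=\tau(r)\delta(s)+\delta(r)s$) and $a,b\in R$ with $xr=\tau(r)x+\delta(r)$ for all $r\in R$ and $x^2=ax+b$, and $A\cong R[x;\tau,\delta]/\langle x^2-ax-b\rangle$, where $R[x;\tau,\delta]$ is the Ore extension (free left $R$-module on $1,x,x^2,\dots$ with $xr=\tau(r)x+\delta(r)$). Fix such data $Q_1=R[x;\tau_1,\delta_1]/\langle x^2-ax-b\rangle$ and $Q_2=R[y;\tau_2,\delta_2]/\langle y^2-cy-d\rangle$ for the two quadratic extensions, with $a,b,c,d\in R$. The amalgamated product $Q_1*_RQ_2$ is the pushout, in the category of rings, of the inclusions $R\hookrightarrow Q_1$ and $R\hookrightarrow Q_2$. A left $\tau$-derivation $\delta$ of $R$ is inner if there exists $s\in R$ with $\delta(r)=\tau(r)s-sr$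 for all $r\in R$. *)

theory Defs
  imports "HOL-Algebra.QuotRing"
begin

locale skew_field = ring R for R (structure) +
  assumes one_not_zero: "\<one> \<noteq> \<zero>"
    and Units_eq: "Units R = carrier R - {\<zero>}"

text \<open>Note that \<open>ideal\<close> and \<open>Idl\<close> are two-sided in HOL-Algebra.\<close>

locale principal_ideal_ring = ring R for R (structure) +
  assumes principal: "ideal I R \<Longrightarrow> principalideal I R"

definition twisted_derivation ::
    "('r, 'm) ring_scheme \<Rightarrow> ('r \<Rightarrow> 'r) \<Rightarrow> ('r \<Rightarrow> 'r) \<Rightarrow> bool" where
  "twisted_derivation R \<tau> \<delta> \<longleftrightarrow>
     \<delta> \<in> carrier R \<rightarrow> carrier R \<and>
     (\<forall>r\<in>carrier R. \<forall>s\<in>carrier R. \<delta> (r \<oplus>\<^bsub>R\<^esub> s) = \<delta> r \<oplus>\<^bsub>R\<^esub> \<delta> s) \<and>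
     (\<forall>r\<in>carrier R. \<forall>s\<in>carrier R.
        \<delta> (r \<otimes>\<^bsub>R\<^esub> s) = \<tau> r \<otimes>\<^bsub>R\<^esub> \<delta> s \<oplus>\<^bsub>R\<^esub> \<delta> r \<otimes>\<^bsub>R\<^esub> s)"

definition inner_twisted_derivation ::
    "('r, 'm) ring_scheme \<Rightarrow> ('r \<Rightarrow> 'r) \<Rightarrow> ('r \<Rightarrow> 'r) \<Rightarrow> bool" where
  "inner_twisted_derivation R \<tau> \<delta> \<longleftrightarrow>
     twisted_derivation R \<tau> \<delta> \<and>
     (\<exists>s\<in>carrier R. \<forall>r\<in>carrier R. \<delta> r = \<tau> r \<otimes>\<^bsub>R\<^esub> s \<ominus>\<^bsub>R\<^esub> s \<otimes>\<^bsub>R\<^esub> r)"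

text \<open>
  A ring extension \<open>R \<subseteq> A\<close> is rendered by an injective ring homomorphism \<open>\<iota>\<close> from \<open>R\<close> to \<open>A\<close>,
  since two extensions of the same ring may live in different types.  The left \<open>R\<close>-module
  structure of \<open>A\<close> is \<open>\<iota> r \<otimes> u\<close>; the unique-existence clause says that it is free with
  basis \<open>{1, x}\<close>.
\<close>

definition quadratic_extension ::
    "('r, 'm) ring_scheme \<Rightarrow> ('a, 'n) ring_scheme \<Rightarrow> ('r \<Rightarrow> 'a) \<Rightarrow> 'a \<Rightarrow> bool" where
  "quadratic_extension R A \<iota> x \<longleftrightarrow>
     ring R \<and> ring A \<and> \<iota> \<in> ring_hom R A \<and> inj_on \<iota> (carrier R) \<and>
     x \<in> carrier A - \<iota> ` carrier R \<and>
     (\<forall>u\<in>carrier A. \<exists>!p. p \<in> carrier R \<times> carrier R \<and>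
        u = \<iota> (fst p) \<otimes>\<^bsub>A\<^esub> \<one>\<^bsub>A\<^esub> \<oplus>\<^bsub>A\<^esub> \<iota> (snd p) \<otimes>\<^bsub>A\<^esub> x)"

text \<open>
  The data \<open>\<tau>\<close>, \<open>\<delta>\<close>, \<open>a\<close>, \<open>b\<close> attached to the generator \<open>x\<close>; they present \<open>A\<close> as the quotient of
  the Ore extension \<open>R[x; \<tau>, \<delta>]\<close> by \<open>x\<^sup>2 - a x - b\<close>.
\<close>

definition quadratic_extension_data ::
    "('r, 'm) ring_scheme \<Rightarrow> ('a, 'n) ring_scheme \<Rightarrow> ('r \<Rightarrow> 'a) \<Rightarrow> 'a \<Rightarrow>
     ('r \<Rightarrow> 'r) \<Rightarrow> ('r \<Rightarrow> 'r) \<Rightarrow> 'r \<Rightarrow> 'r \<Rightarrow> bool" where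
  "quadratic_extension_data R A \<iota> x \<tau> \<delta> a b \<longleftrightarrow>
     quadratic_extension R A \<iota> x \<and>
     \<tau> \<in> ring_hom R R \<and> twisted_derivation R \<tau> \<delta> \<and> a \<in> carrier R \<and> b \<in> carrier R \<and>
     (\<forall>r\<in>carrier R. x \<otimes>\<^bsub>A\<^esub> \<iota> r = \<iota> (\<tau> r) \<otimes>\<^bsub>A\<^esub> x \<oplus>\<^bsub>A\<^esub> \<iota> (\<delta> r)) \<and>
     x \<otimes>\<^bsub>A\<^esub> x = \<iota> a \<otimes>\<^bsub>A\<^esub> x \<oplus>\<^bsub>A\<^esub> \<iota> b"

text \<open>
  The pushout of ring homomorphisms \<open>f\<close> from \<open>R\<close> to \<open>A\<close> and \<open>g\<close> from \<open>R\<close> to \<open>B\<close>, by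
  generators and relations: formal ring expressions in the elements of \<open>A\<close> and \<open>B\<close>, modulo the
  least congruence that satisfies the ring axioms, makes both insertions of generators ring
  homomorphisms, and identifies \<open>f r\<close> with \<open>g r\<close>.  Its universal property, with respect
  to rings over arbitrary types, is \<open>amalgamated_product_universal\<close> below.
\<close>

datatype ('a, 'b) ring_term =
    In1 'a | In2 'b | TZero | TOne
  | TNeg "('a, 'b) ring_term"
  | TAdd "('a, 'b) ring_term" "('a, 'b) ring_term"
  | TMul "('a, 'b) ring_term" "('a, 'b) ring_term"

definition ring_terms ::
    "('a, 'm) ring_scheme \<Rightarrow> ('b, 'n) ring_scheme \<Rightarrow> ('a, 'b) ring_term set" where
  "ring_terms A B = {t. set1_ring_term t \<subseteq> carrier A \<and> set2_ring_term t \<subseteq> carrier B}"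

inductive amalg_eq ::
    "('r, 'k) ring_scheme \<Rightarrow> ('a, 'm) ring_scheme \<Rightarrow> ('r \<Rightarrow> 'a) \<Rightarrow> ('b, 'n) ring_scheme \<Rightarrow>
     ('r \<Rightarrow> 'b) \<Rightarrow> ('a, 'b) ring_term \<Rightarrow> ('a, 'b) ring_term \<Rightarrow> bool"
  for R A f B g
where
  refl: "s \<in> ring_terms A B \<Longrightarrow> amalg_eq R A f B g s s"
| sym: "amalg_eq R A f B g s t \<Longrightarrow> amalg_eq R A f B g t s"
| trans: "amalg_eq R A f B g s t \<Longrightarrow> amalg_eq R A f B g t u \<Longrightarrow> amalg_eq R A f B g s u"
| neg_cong: "amalg_eq R A f B g s s' \<Longrightarrow> amalg_eq R A f B g (TNeg s) (TNeg s')"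
| add_cong: "amalg_eq R A f B g s s' \<Longrightarrow> amalg_eq R A f B g t t' \<Longrightarrow>
    amalg_eq R A f B g (TAdd s t) (TAdd s' t')"
| mul_cong: "amalg_eq R A f B g s s' \<Longrightarrow> amalg_eq R A f B g t t' \<Longrightarrow>
    amalg_eq R A f B g (TMul s t) (TMul s' t')"
| add_assoc: "s \<in> ring_terms A B \<Longrightarrow> t \<in> ring_terms A B \<Longrightarrow> u \<in> ring_terms A B \<Longrightarrow>
    amalg_eq R A f B g (TAdd (TAdd s t) u) (TAdd s (TAdd t u))"
| add_comm: "s \<in> ring_terms A B \<Longrightarrow> t \<in> ring_terms A B \<Longrightarrow>
    amalg_eq R A f B g (TAdd s t) (TAdd t s)"
| add_zero: "s \<in> ring_terms A B \<Longrightarrow> amalg_eq R A f B g (TAdd TZero s) s"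
| add_neg: "s \<in> ring_terms A B \<Longrightarrow> amalg_eq R A f B g (TAdd (TNeg s) s) TZero"
| mul_assoc: "s \<in> ring_terms A B \<Longrightarrow> t \<in> ring_terms A B \<Longrightarrow> u \<in> ring_terms A B \<Longrightarrow>
    amalg_eq R A f B g (TMul (TMul s t) u) (TMul s (TMul t u))"
| one_mul: "s \<in> ring_terms A B \<Longrightarrow> amalg_eq R A f B g (TMul TOne s) s"
| mul_one: "s \<in> ring_terms A B \<Longrightarrow> amalg_eq R A f B g (TMul s TOne) s"
| distrib_right: "s \<in> ring_terms A B \<Longrightarrow> t \<in> ring_terms A B \<Longrightarrow> u \<in> ring_terms A B \<Longrightarrow>
    amalg_eq R A f B g (TMul (TAdd s t) u) (TAdd (TMul s u) (TMul t u))"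
| distrib_left: "s \<in> ring_terms A B \<Longrightarrow> t \<in> ring_terms A B \<Longrightarrow> u \<in> ring_terms A B \<Longrightarrow>
    amalg_eq R A f B g (TMul u (TAdd s t)) (TAdd (TMul u s) (TMul u t))"
| in1_add: "a \<in> carrier A \<Longrightarrow> a' \<in> carrier A \<Longrightarrow>
    amalg_eq R A f B g (In1 (a \<oplus>\<^bsub>A\<^esub> a')) (TAdd (In1 a) (In1 a'))"
| in1_mul: "a \<in> carrier A \<Longrightarrow> a' \<in> carrier A \<Longrightarrow>
    amalg_eq R A f B g (In1 (a \<otimes>\<^bsub>A\<^esub> a')) (TMul (In1 a) (In1 a'))"
| in1_one: "amalg_eq R A f B g (In1 \<one>\<^bsub>A\<^esub>) TOne"
| in2_add: "b \<in> carrier B \<Longrightarrow> b' \<in> carrier B \<Longrightarrow>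
    amalg_eq R A f B g (In2 (b \<oplus>\<^bsub>B\<^esub> b')) (TAdd (In2 b) (In2 b'))"
| in2_mul: "b \<in> carrier B \<Longrightarrow> b' \<in> carrier B \<Longrightarrow>
    amalg_eq R A f B g (In2 (b \<otimes>\<^bsub>B\<^esub> b')) (TMul (In2 b) (In2 b'))"
| in2_one: "amalg_eq R A f B g (In2 \<one>\<^bsub>B\<^esub>) TOne"
| glue: "r \<in> carrier R \<Longrightarrow> amalg_eq R A f B g (In1 (f r)) (In2 (g r))"

definition amalg_class ::
    "('r, 'k) ring_scheme \<Rightarrow> ('a, 'm) ring_scheme \<Rightarrow> ('r \<Rightarrow> 'a) \<Rightarrow> ('b, 'n) ring_scheme \<Rightarrow>
     ('r \<Rightarrow> 'b) \<Rightarrow> ('a, 'b) ring_term \<Rightarrow> ('a, 'b) ring_term set" where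
  "amalg_class R A f B g s = {t. amalg_eq R A f B g s t}"

definition amalgamated_product ::
    "('r, 'k) ring_scheme \<Rightarrow> ('a, 'm) ring_scheme \<Rightarrow> ('r \<Rightarrow> 'a) \<Rightarrow> ('b, 'n) ring_scheme \<Rightarrow>
     ('r \<Rightarrow> 'b) \<Rightarrow> ('a, 'b) ring_term set ring" where
  "amalgamated_product R A f B g =
     \<lparr>carrier = amalg_class R A f B g ` ring_terms A B,
      monoid.mult = (\<lambda>X Y. \<Union>s\<in>X. \<Union>t\<in>Y. amalg_class R A f B g (TMul s t)),
      one = amalg_class R A f B g TOne,
      zero = amalg_class R A f B g TZero,
      add = (\<lambda>X Y. \<Union>s\<in>X. \<Union>t\<in>Y. amalg_class R A f B g (TAdd s t))\<rparr>"

locale ring_span = R: ring R + A: ring A + B: ring B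
  for R :: "('r, 'k) ring_scheme" and A :: "('a, 'm) ring_scheme"
    and B :: "('b, 'n) ring_scheme" +
  fixes f :: "'r \<Rightarrow> 'a" and g :: "'r \<Rightarrow> 'b"
  assumes f_hom: "f \<in> ring_hom R A" and g_hom: "g \<in> ring_hom R B"
begin

abbreviation "P \<equiv> amalgamated_product R A f B g"
abbreviation "T \<equiv> ring_terms A B"
abbreviation "eqv \<equiv> amalg_eq R A f B g"
abbreviation "cls \<equiv> amalg_class R A f B g"
abbreviation "amalg_in1 \<equiv> (\<lambda>a. cls (In1 a))"
abbreviation "amalg_in2 \<equiv> (\<lambda>b. cls (In2 b))"

lemma terms_simps [simp]:
  "In1 a \<in> T \<longleftrightarrow> a \<in> carrier A" "In2 b \<in> T \<longleftrightarrow> b \<in> carrier B"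
  "TZero \<in> T" "TOne \<in> T" "TNeg s \<in> T \<longleftrightarrow> s \<in> T"
  "TAdd s t \<in> T \<longleftrightarrow> s \<in> T \<and> t \<in> T" "TMul s t \<in> T \<longleftrightarrow> s \<in> T \<and> t \<in> T"
  by (auto simp: ring_terms_def)

lemma eqv_terms: "eqv s t \<Longrightarrow> s \<in> T \<and> t \<in> T"
  by (induction rule: amalg_eq.induct)
    (auto simp: ring_hom_closed[OF f_hom] ring_hom_closed[OF g_hom])

lemma cls_eq_iff: "s \<in> T \<Longrightarrow> cls s = cls t \<longleftrightarrow> eqv s t"
  unfolding amalg_class_def by (blast intro: amalg_eq.refl amalg_eq.sym amalg_eq.trans)

lemma cls_eqI: "eqv s t \<Longrightarrow> cls s = cls t"
  using cls_eq_iff eqv_terms by blast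

lemma add_cls:
  assumes "s \<in> T" "t \<in> T"
  shows "cls s \<oplus>\<^bsub>P\<^esub> cls t = cls (TAdd s t)"
proof -
  have "cls (TAdd s' t') = cls (TAdd s t)" if "s' \<in> cls s" "t' \<in> cls t" for s' t'
    using that unfolding amalg_class_def[of _ _ _ _ _ s] amalg_class_def[of _ _ _ _ _ t]
    by (intro cls_eqI[symmetric] amalg_eq.add_cong) simp_all
  moreover have "s \<in> cls s" "t \<in> cls t"
    using assms by (auto simp: amalg_class_def intro: amalg_eq.refl)
  ultimately have "(\<Union>s'\<in>cls s. \<Union>t'\<in>cls t. cls (TAdd s' t')) = cls (TAdd s t)" by blast
  then show ?thesis by (simp add: amalgamated_product_def)
qed

lemma mult_cls:
  assumes "s \<in> T" "t \<in> T"
  shows "cls s \<otimes>\<^bsub>P\<^esub> cls t = cls (TMul s t)"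
proof -
  have "cls (TMul s' t') = cls (TMul s t)" if "s' \<in> cls s" "t' \<in> cls t" for s' t'
    using that unfolding amalg_class_def[of _ _ _ _ _ s] amalg_class_def[of _ _ _ _ _ t]
    by (intro cls_eqI[symmetric] amalg_eq.mul_cong) simp_all
  moreover have "s \<in> cls s" "t \<in> cls t"
    using assms by (auto simp: amalg_class_def intro: amalg_eq.refl)
  ultimately have "(\<Union>s'\<in>cls s. \<Union>t'\<in>cls t. cls (TMul s' t')) = cls (TMul s t)" by blast
  then show ?thesis by (simp add: amalgamated_product_def)
qed

lemma carrier_P: "carrier P = cls ` T"
  and zero_P: "\<zero>\<^bsub>P\<^esub> = cls TZero"
  and one_P: "\<one>\<^bsub>P\<^esub> = cls TOne"
  by (simp_all add: amalgamated_product_def)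

lemma ring_amalgamated_product: "ring P"
proof (rule ringI)
  show "abelian_group P"
  proof (rule abelian_groupI)
    fix x assume "x \<in> carrier P"
    then obtain s where s: "s \<in> T" "x = cls s" by (auto simp: carrier_P)
    have "cls (TNeg s) \<oplus>\<^bsub>P\<^esub> x = \<zero>\<^bsub>P\<^esub>"
      using s by (simp add: add_cls zero_P) (rule cls_eqI, rule amalg_eq.add_neg)
    moreover have "cls (TNeg s) \<in> carrier P" using s by (simp add: carrier_P)
    ultimately show "\<exists>y\<in>carrier P. y \<oplus>\<^bsub>P\<^esub> x = \<zero>\<^bsub>P\<^esub>" by blast
  qed (clarsimp simp: carrier_P zero_P add_cls cls_eq_iff imageI
         amalg_eq.add_assoc amalg_eq.add_comm amalg_eq.add_zero)+
  show "monoid P"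
    by (rule monoidI; clarsimp simp: carrier_P one_P mult_cls cls_eq_iff imageI
         amalg_eq.mul_assoc amalg_eq.one_mul amalg_eq.mul_one)
qed (clarsimp simp: carrier_P add_cls mult_cls cls_eq_iff imageI
       amalg_eq.distrib_left amalg_eq.distrib_right)+

lemma amalg_in1_hom: "amalg_in1 \<in> ring_hom A P"
  by (rule ring_hom_memI; simp add: carrier_P one_P add_cls mult_cls cls_eq_iff imageI
       amalg_eq.in1_add amalg_eq.in1_mul amalg_eq.in1_one)

lemma amalg_in2_hom: "amalg_in2 \<in> ring_hom B P"
  by (rule ring_hom_memI; simp add: carrier_P one_P add_cls mult_cls cls_eq_iff imageI
       amalg_eq.in2_add amalg_eq.in2_mul amalg_eq.in2_one)

lemma amalg_in_commute: "r \<in> carrier R \<Longrightarrow> amalg_in1 (f r) = amalg_in2 (g r)"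
  by (intro cls_eqI amalg_eq.glue)

primrec eval_term ::
    "('c, 'l) ring_scheme \<Rightarrow> ('a \<Rightarrow> 'c) \<Rightarrow> ('b \<Rightarrow> 'c) \<Rightarrow> ('a, 'b) ring_term \<Rightarrow> 'c" where
  "eval_term S u v (In1 a) = u a"
| "eval_term S u v (In2 b) = v b"
| "eval_term S u v TZero = \<zero>\<^bsub>S\<^esub>"
| "eval_term S u v TOne = \<one>\<^bsub>S\<^esub>"
| "eval_term S u v (TNeg s) = \<ominus>\<^bsub>S\<^esub> eval_term S u v s"
| "eval_term S u v (TAdd s t) = eval_term S u v s \<oplus>\<^bsub>S\<^esub> eval_term S u v t"
| "eval_term S u v (TMul s t) = eval_term S u v s \<otimes>\<^bsub>S\<^esub> eval_term S u v t"

lemma amalgamated_product_universal: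
  fixes S :: "('c, 'l) ring_scheme"
  assumes S: "ring S" and u: "u \<in> ring_hom A S" and v: "v \<in> ring_hom B S"
    and uv: "\<And>r. r \<in> carrier R \<Longrightarrow> u (f r) = v (g r)"
  shows "\<exists>h\<in>ring_hom P S.
    (\<forall>a\<in>carrier A. h (amalg_in1 a) = u a) \<and> (\<forall>b\<in>carrier B. h (amalg_in2 b) = v b) \<and>
    (\<forall>h'\<in>ring_hom P S.
       (\<forall>a\<in>carrier A. h' (amalg_in1 a) = u a) \<and> (\<forall>b\<in>carrier B. h' (amalg_in2 b) = v b) \<longrightarrow>
       (\<forall>p\<in>carrier P. h' p = h p))"
proof -
  interpret S: ring S by fact
  interpret P: ring P by (rule ring_amalgamated_product)
  let ?e = "eval_term S u v"
  have clo: "?e s \<in> carrier S" if "s \<in> T" for s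
    using that by (induction s) (auto simp: ring_hom_closed[OF u] ring_hom_closed[OF v])
  have resp: "?e s = ?e t" if "eqv s t" for s t
    using that
  proof (induction rule: amalg_eq.induct)
    case (add_comm s t)
    then show ?case by (simp add: clo S.add.m_comm)
  qed (simp_all add: clo S.add.m_assoc S.m_assoc S.l_neg S.l_distr S.r_distr uv
         ring_hom_add[OF u] ring_hom_add[OF v] ring_hom_mult[OF u] ring_hom_mult[OF v]
         ring_hom_one[OF u] ring_hom_one[OF v])
  define h where "h X = ?e (SOME s. s \<in> X)" for X
  have h_cls: "h (cls s) = ?e s" if "s \<in> T" for s
  proof -
    have "s \<in> cls s" using that by (auto simp: amalg_class_def intro: amalg_eq.refl)
    then have "(SOME t. t \<in> cls s) \<in> cls s" by (rule someI)
    then show ?thesis unfolding h_def amalg_class_def by (auto dest: resp)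
  qed
  have h_hom: "h \<in> ring_hom P S"
    by (rule ring_hom_memI) (auto simp: carrier_P one_P add_cls mult_cls h_cls clo)
  have uniq: "\<forall>p\<in>carrier P. h' p = h p"
    if h': "h' \<in> ring_hom P S" and h'1: "\<forall>a\<in>carrier A. h' (amalg_in1 a) = u a"
      and h'2: "\<forall>b\<in>carrier B. h' (amalg_in2 b) = v b" for h'
  proof -
    interpret h': ring_hom_ring P S h'
      using h' by (intro ring_hom_ringI2 P.ring_axioms S.ring_axioms)
    have "h' (cls s) = ?e s" if "s \<in> T" for s
      using that
    proof (induction s)
      case (TNeg s)
      have "cls (TNeg s) \<oplus>\<^bsub>P\<^esub> cls s = \<zero>\<^bsub>P\<^esub>"
        using TNeg.prems by (simp add: add_cls zero_P) (rule cls_eqI, rule amalg_eq.add_neg)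
      then have "cls (TNeg s) = \<ominus>\<^bsub>P\<^esub> cls s"
        using TNeg.prems by (intro P.minus_equality[symmetric]) (auto simp: carrier_P)
      then show ?case using TNeg by (simp add: carrier_P)
    next
      case (TAdd s t)
      then have "h' (cls s \<oplus>\<^bsub>P\<^esub> cls t) = ?e (TAdd s t)"
        by (subst h'.hom_add) (auto simp: carrier_P)
      then show ?case using TAdd.prems by (simp add: add_cls)
    next
      case (TMul s t)
      then have "h' (cls s \<otimes>\<^bsub>P\<^esub> cls t) = ?e (TMul s t)"
        by (subst h'.hom_mult) (auto simp: carrier_P)
      then show ?case using TMul.prems by (simp add: mult_cls)
    qed (use h'1 h'2 h'.hom_one in \<open>auto simp flip: zero_P one_P\<close>)
    then show ?thesis by (auto simp: carrier_P h_cls)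
  qed
  show ?thesis
  proof (intro bexI[OF _ h_hom] conjI)
    show "\<forall>a\<in>carrier A. h (amalg_in1 a) = u a" "\<forall>b\<in>carrier B. h (amalg_in2 b) = v b"
      by (simp_all add: h_cls)
  qed (use uniq in blast)
qed

end

end

theory Submission
  imports Defs
begin

text \<open>Let \<open>Q\<close> be the amalgamated product. The proof rests on a normal form: the alternating words
  \<open>X\<^sub>n = xyx\<dots>\<close> and \<open>Y\<^sub>n = yxy\<dots>\<close> of length \<open>n\<close> form a left \<open>R\<close>-basis of \<open>Q\<close>, where \<open>X\<^sub>0 = Y\<^sub>0 = 1\<close>.
  They span by the commutation rules. They are independent because \<open>Q\<close> acts on the functions
  \<open>\<int> \<Rightarrow> R\<close>, the value at \<open>n\<close> standing for the coefficient of \<open>X\<^sub>n\<close> and the value at \<open>-n\<close> for that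
  of \<open>Y\<^sub>n\<close>: left multiplication by \<open>x\<close> only mixes the coefficients at \<open>i\<close> and \<open>1 - i\<close>, and such a
  pair is a copy of \<open>Q\<^sub>1\<close>; left multiplication by \<open>y\<close> only mixes those at \<open>i\<close> and \<open>-1 - i\<close>, and such a
  pair is a copy of \<open>Q\<^sub>2\<close>. The two actions agree on \<open>R\<close>, so they combine to an action of \<open>Q\<close>
  (\<open>act_respects\<close>), and applying \<open>q\<close> to the unit function at \<open>0\<close> reads off the coefficients of \<open>q\<close>.

  Let \<open>F\<^sub>n\<close> be the span of the words of length at most \<open>n\<close>, let \<open>I\<close> be a nonzero ideal, let \<open>n\<close> be
  minimal with \<open>I \<inter> F\<^sub>n \<noteq> 0\<close>, and let \<open>0 \<noteq> f \<in> I \<inter> F\<^sub>n\<close>. If \<open>n \<ge> 1\<close>, then \<open>f\<close> cannot lead with \<open>X\<^sub>n\<close>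
  alone (\<open>one_sided_leading_zero\<close>). Suppose it did, with leading coefficient scaled to 1. Every
  commutator \<open>f r - \<tau>(r) f\<close>, with \<open>\<tau>\<close> the twist of \<open>X\<^sub>n\<close>, lies in \<open>I \<inter> F\<^bsub>n-1\<^esub> = 0\<close>. Moving \<open>r\<close>
  across \<open>X\<^sub>n\<close> produces a multiple of \<open>Y\<^bsub>n-1\<^esub>\<close> through \<open>\<delta>\<^sub>1\<close> of the first letter, and vanishing of
  the coefficient of \<open>Y\<^bsub>n-1\<^esub>\<close> writes \<open>\<delta>\<^sub>1\<close> as an inner derivation, because the twist of
  \<open>Y\<^bsub>n-1\<^esub>\<close> is onto. By symmetry \<open>f\<close> cannot lead with \<open>Y\<^sub>n\<close> alone either, as \<open>\<delta>\<^sub>2\<close> is not inner.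

  Hence both leading coefficients of \<open>f\<close> are nonzero (for \<open>n = 0\<close> they are the same scalar), and
  \<open>I \<inter> F\<^sub>n = R f\<close>, since subtracting a multiple of \<open>f\<close> from another element removes one of its two
  leading terms, which leaves no nonzero element. Moreover
  \<open>x f\<close> leads with a multiple of \<open>X\<^bsub>n+1\<^esub>\<close> alone and \<open>y f\<close> with a multiple of \<open>Y\<^bsub>n+1\<^esub>\<close> alone, and so on
  upwards (\<open>leading_transfer\<close>). So every leading term of length above \<open>n\<close> can be cancelled by
  left multiples of \<open>f\<close>, and division with remainder shows that \<open>f\<close> generates \<open>I\<close>.\<close>

section \<open>Rings with alternating normal forms\<close>

primrec alt_word :: "('q, 'm) ring_scheme \<Rightarrow> nat \<Rightarrow> 'q \<Rightarrow> 'q \<Rightarrow> 'q" where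
  "alt_word Q 0 u v = \<one>\<^bsub>Q\<^esub>"
| "alt_word Q (Suc n) u v = u \<otimes>\<^bsub>Q\<^esub> alt_word Q n v u"

text \<open>The twist of an alternating word: moving a scalar \<open>r\<close> from the right to the left of
  \<open>alt_word Q n x y\<close> turns it, up to shorter words, into \<open>alt_comp n \<tau>1 \<tau>2 r\<close>.\<close>

primrec alt_comp :: "nat \<Rightarrow> ('r \<Rightarrow> 'r) \<Rightarrow> ('r \<Rightarrow> 'r) \<Rightarrow> 'r \<Rightarrow> 'r" where
  "alt_comp 0 \<sigma> \<tau> r = r"
| "alt_comp (Suc n) \<sigma> \<tau> r = \<sigma> (alt_comp n \<tau> \<sigma> r)"

primrec word_span ::
    "('q, 'm) ring_scheme \<Rightarrow> ('r, 'k) ring_scheme \<Rightarrow> ('r \<Rightarrow> 'q) \<Rightarrow> 'q \<Rightarrow> 'q \<Rightarrow> nat \<Rightarrow> 'q set" where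
  "word_span Q R \<iota> x y 0 = \<iota> ` carrier R"
| "word_span Q R \<iota> x y (Suc n) =
     {(\<iota> r \<otimes>\<^bsub>Q\<^esub> alt_word Q (Suc n) x y \<oplus>\<^bsub>Q\<^esub> \<iota> s \<otimes>\<^bsub>Q\<^esub> alt_word Q (Suc n) y x) \<oplus>\<^bsub>Q\<^esub> v | r s v.
        r \<in> carrier R \<and> s \<in> carrier R \<and> v \<in> word_span Q R \<iota> x y n}"

text \<open>What the ideal theory needs to know about the amalgamated product. The function \<open>coef q\<close>
  lists the coordinates of \<open>q\<close> with respect to the alternating words, those starting with \<open>x\<close> at
  positive and those starting with \<open>y\<close> at negative indices. The formulas for \<open>x \<otimes> q\<close> express that
  \<open>x\<close> maps the word of index \<open>i \<le> 0\<close> to that of index \<open>1 - i\<close>, whose product with \<open>x\<close> is in turn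
  rewritten by \<open>x_square\<close>. Those for \<open>y\<close> are the same formulas at the negated index, which
  makes the axioms invariant under exchanging \<open>x\<close> and \<open>y\<close>. Linear independence of the words is
  contained in the existence of \<open>coef\<close>; that they span follows from \<open>generated\<close>.\<close>

locale alternating_ring = Q: ring Q + R: skew_field R
  for Q :: "('q, 'm) ring_scheme" (structure) and R :: "('r, 'k) ring_scheme" +
  fixes \<iota> :: "'r \<Rightarrow> 'q" and x y :: 'q and coef :: "'q \<Rightarrow> int \<Rightarrow> 'r"
    and \<tau>1 \<delta>1 :: "'r \<Rightarrow> 'r" and a b :: 'r and \<tau>2 \<delta>2 :: "'r \<Rightarrow> 'r" and c d :: 'r
  assumes emb: "\<iota> \<in> ring_hom R Q"
    and x_closed [simp]: "x \<in> carrier Q" and y_closed [simp]: "y \<in> carrier Q"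
    and iso1: "\<tau>1 \<in> ring_iso R R" and iso2: "\<tau>2 \<in> ring_iso R R"
    and der1: "twisted_derivation R \<tau>1 \<delta>1" and der2: "twisted_derivation R \<tau>2 \<delta>2"
    and consts1: "a \<in> carrier R" "b \<in> carrier R" and consts2: "c \<in> carrier R" "d \<in> carrier R"
    and x_comm: "r \<in> carrier R \<Longrightarrow> x \<otimes> \<iota> r = \<iota> (\<tau>1 r) \<otimes> x \<oplus> \<iota> (\<delta>1 r)"
    and y_comm: "r \<in> carrier R \<Longrightarrow> y \<otimes> \<iota> r = \<iota> (\<tau>2 r) \<otimes> y \<oplus> \<iota> (\<delta>2 r)"
    and x_square: "x \<otimes> x = \<iota> a \<otimes> x \<oplus> \<iota> b"
    and y_square: "y \<otimes> y = \<iota> c \<otimes> y \<oplus> \<iota> d"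
    and generated: "\<lbrakk>V \<subseteq> carrier Q; \<one> \<in> V; \<And>u v. u \<in> V \<Longrightarrow> v \<in> V \<Longrightarrow> u \<oplus> v \<in> V;
      \<And>r v. r \<in> carrier R \<Longrightarrow> v \<in> V \<Longrightarrow> \<iota> r \<otimes> v \<in> V;
      \<And>v. v \<in> V \<Longrightarrow> x \<otimes> v \<in> V; \<And>v. v \<in> V \<Longrightarrow> y \<otimes> v \<in> V\<rbrakk> \<Longrightarrow> carrier Q \<subseteq> V"
    and coef_closed [simp]: "q \<in> carrier Q \<Longrightarrow> coef q i \<in> carrier R"
    and coef_one: "coef \<one> i = (if i = 0 then \<one>\<^bsub>R\<^esub> else \<zero>\<^bsub>R\<^esub>)"
    and coef_add: "p \<in> carrier Q \<Longrightarrow> q \<in> carrier Q \<Longrightarrow> coef (p \<oplus> q) i = coef p i \<oplus>\<^bsub>R\<^esub> coef q i"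
    and coef_scal: "r \<in> carrier R \<Longrightarrow> q \<in> carrier Q \<Longrightarrow> coef (\<iota> r \<otimes> q) i = r \<otimes>\<^bsub>R\<^esub> coef q i"
    and coef_x_pos: "q \<in> carrier Q \<Longrightarrow> 1 \<le> i \<Longrightarrow> coef (x \<otimes> q) i =
      \<tau>1 (coef q (1 - i)) \<oplus>\<^bsub>R\<^esub> \<tau>1 (coef q i) \<otimes>\<^bsub>R\<^esub> a \<oplus>\<^bsub>R\<^esub> \<delta>1 (coef q i)"
    and coef_x_nonpos: "q \<in> carrier Q \<Longrightarrow> i \<le> 0 \<Longrightarrow> coef (x \<otimes> q) i =
      \<delta>1 (coef q i) \<oplus>\<^bsub>R\<^esub> \<tau>1 (coef q (1 - i)) \<otimes>\<^bsub>R\<^esub> b"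
    and coef_y_pos: "q \<in> carrier Q \<Longrightarrow> 1 \<le> i \<Longrightarrow> coef (y \<otimes> q) (- i) =
      \<tau>2 (coef q (- (1 - i))) \<oplus>\<^bsub>R\<^esub> \<tau>2 (coef q (- i)) \<otimes>\<^bsub>R\<^esub> c \<oplus>\<^bsub>R\<^esub> \<delta>2 (coef q (- i))"
    and coef_y_nonpos: "q \<in> carrier Q \<Longrightarrow> i \<le> 0 \<Longrightarrow> coef (y \<otimes> q) (- i) =
      \<delta>2 (coef q (- i)) \<oplus>\<^bsub>R\<^esub> \<tau>2 (coef q (- (1 - i))) \<otimes>\<^bsub>R\<^esub> d"
begin

abbreviation "X n \<equiv> alt_word Q n x y"
abbreviation "Y n \<equiv> alt_word Q n y x"
abbreviation "F \<equiv> word_span Q R \<iota> x y"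

text \<open>Every statement about \<open>x\<close> has a mirror image about \<open>y\<close>, obtained by negating the indices.\<close>

lemma swap: "alternating_ring Q R \<iota> y x (\<lambda>q i. coef q (- i)) \<tau>2 \<delta>2 c d \<tau>1 \<delta>1 a b"
proof unfold_locales
  fix V assume "V \<subseteq> carrier Q" "\<one> \<in> V" "\<And>u v. u \<in> V \<Longrightarrow> v \<in> V \<Longrightarrow> u \<oplus> v \<in> V"
    "\<And>r v. r \<in> carrier R \<Longrightarrow> v \<in> V \<Longrightarrow> \<iota> r \<otimes> v \<in> V"
    "\<And>v. v \<in> V \<Longrightarrow> y \<otimes> v \<in> V" "\<And>v. v \<in> V \<Longrightarrow> x \<otimes> v \<in> V"
  then show "carrier Q \<subseteq> V" using generated[of V] by blast
qed (use emb iso1 iso2 der1 der2 consts1 consts2 x_comm y_comm x_square y_square coef_one coef_add coef_scal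
   coef_x_pos coef_x_nonpos coef_y_pos coef_y_nonpos in auto)

sublocale \<iota>: ring_hom_ring R Q \<iota>
  by (intro ring_hom_ringI2 R.ring_axioms Q.ring_axioms emb)

lemma hom1: "\<tau>1 \<in> ring_hom R R" using iso1 by (simp add: ring_iso_def)

sublocale \<tau>1: ring_hom_ring R R \<tau>1
  by (intro ring_hom_ringI2 R.ring_axioms hom1)

lemma \<delta>1_closed [simp]: "r \<in> carrier R \<Longrightarrow> \<delta>1 r \<in> carrier R"
  using der1 by (auto simp: twisted_derivation_def)

lemma \<delta>1_zero [simp]: "\<delta>1 \<zero>\<^bsub>R\<^esub> = \<zero>\<^bsub>R\<^esub>"
proof -
  have "\<delta>1 (\<zero>\<^bsub>R\<^esub> \<oplus>\<^bsub>R\<^esub> \<zero>\<^bsub>R\<^esub>) = \<delta>1 \<zero>\<^bsub>R\<^esub> \<oplus>\<^bsub>R\<^esub> \<delta>1 \<zero>\<^bsub>R\<^esub>"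
    using der1 unfolding twisted_derivation_def by blast
  then have "\<delta>1 \<zero>\<^bsub>R\<^esub> \<oplus>\<^bsub>R\<^esub> \<delta>1 \<zero>\<^bsub>R\<^esub> = \<delta>1 \<zero>\<^bsub>R\<^esub>" by simp
  then show ?thesis by (subst (asm) R.add.l_cancel_one) auto
qed

lemma \<delta>1_one [simp]: "\<delta>1 \<one>\<^bsub>R\<^esub> = \<zero>\<^bsub>R\<^esub>"
proof -
  have "\<delta>1 (\<one>\<^bsub>R\<^esub> \<otimes>\<^bsub>R\<^esub> \<one>\<^bsub>R\<^esub>) = \<tau>1 \<one>\<^bsub>R\<^esub> \<otimes>\<^bsub>R\<^esub> \<delta>1 \<one>\<^bsub>R\<^esub> \<oplus>\<^bsub>R\<^esub> \<delta>1 \<one>\<^bsub>R\<^esub> \<otimes>\<^bsub>R\<^esub> \<one>\<^bsub>R\<^esub>"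
    using der1 unfolding twisted_derivation_def by blast
  then have "\<delta>1 \<one>\<^bsub>R\<^esub> \<oplus>\<^bsub>R\<^esub> \<delta>1 \<one>\<^bsub>R\<^esub> = \<delta>1 \<one>\<^bsub>R\<^esub>" by simp
  then show ?thesis by (subst (asm) R.add.l_cancel_one) auto
qed

lemma \<tau>1_eq_zero_iff: "r \<in> carrier R \<Longrightarrow> \<tau>1 r = \<zero>\<^bsub>R\<^esub> \<longleftrightarrow> r = \<zero>\<^bsub>R\<^esub>"
proof -
  assume "r \<in> carrier R"
  moreover have "inj_on \<tau>1 (carrier R)" using iso1 by (simp add: ring_iso_def bij_betw_def)
  ultimately have "\<tau>1 r = \<tau>1 \<zero>\<^bsub>R\<^esub> \<longleftrightarrow> r = \<zero>\<^bsub>R\<^esub>"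
    using inj_on_eq_iff[of \<tau>1 "carrier R" r "\<zero>\<^bsub>R\<^esub>"] by simp
  then show ?thesis by simp
qed

lemma hom2: "\<tau>2 \<in> ring_hom R R" using iso2 by (simp add: ring_iso_def)

sublocale \<tau>2: ring_hom_ring R R \<tau>2
  by (intro ring_hom_ringI2 R.ring_axioms hom2)

lemmas \<delta>2_zero [simp] = alternating_ring.\<delta>1_zero[OF swap]

lemma \<tau>1_image: "\<tau>1 ` carrier R = carrier R"
  using iso1 by (simp add: ring_iso_def bij_betw_def)

lemma \<tau>2_image: "\<tau>2 ` carrier R = carrier R"
  using iso2 by (simp add: ring_iso_def bij_betw_def)

lemma alt_comp_image:
  "alt_comp n \<tau>1 \<tau>2 ` carrier R = carrier R \<and> alt_comp n \<tau>2 \<tau>1 ` carrier R = carrier R"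
proof (induction n)
  case (Suc n)
  then show ?case using \<tau>1_image \<tau>2_image
    by (metis (no_types, lifting) alt_comp.simps(2) image_cong image_image)
qed auto

lemma alt_comp_closed [simp]:
  "r \<in> carrier R \<Longrightarrow> alt_comp n \<tau>1 \<tau>2 r \<in> carrier R"
  "r \<in> carrier R \<Longrightarrow> alt_comp n \<tau>2 \<tau>1 r \<in> carrier R"
  using alt_comp_image by blast+

subsection \<open>The filtration by word length\<close>

lemma alt_word_closed [simp]: "X n \<in> carrier Q" "Y n \<in> carrier Q"
  by (induction n) auto

lemma word_span_swap: "word_span Q R \<iota> y x n = F n"
proof (induction n)
  case (Suc n)
  have "\<iota> r \<otimes> Y (Suc n) \<oplus> \<iota> s \<otimes> X (Suc n) = \<iota> s \<otimes> X (Suc n) \<oplus> \<iota> r \<otimes> Y (Suc n)"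
    if "r \<in> carrier R" "s \<in> carrier R" for r s
    using that by (intro Q.a_comm Q.m_closed \<iota>.hom_closed alt_word_closed)
  then show ?case unfolding word_span.simps Suc.IH by (metis (no_types, opaque_lifting))
qed simp

lemma F_sub: "v \<in> F n \<Longrightarrow> v \<in> carrier Q"
  by (induction n arbitrary: v) (auto simp del: alt_word.simps)

lemma F_memI: "r \<in> carrier R \<Longrightarrow> s \<in> carrier R \<Longrightarrow> v \<in> F n \<Longrightarrow>
    (\<iota> r \<otimes> X (Suc n) \<oplus> \<iota> s \<otimes> Y (Suc n)) \<oplus> v \<in> F (Suc n)"
  unfolding word_span.simps by blast

lemma F_memE:
  assumes "v \<in> F (Suc n)"
  obtains r s w where "r \<in> carrier R" "s \<in> carrier R" "w \<in> F n"
    "v = (\<iota> r \<otimes> X (Suc n) \<oplus> \<iota> s \<otimes> Y (Suc n)) \<oplus> w"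
  using assms unfolding word_span.simps by blast

lemma F_zero: "\<zero> \<in> F n"
proof (induction n)
  case 0 show ?case using \<iota>.hom_zero R.zero_closed by (metis image_eqI word_span.simps(1))
next
  case (Suc n)
  from F_memI[OF R.zero_closed R.zero_closed Suc] show ?case by (simp del: alt_word.simps word_span.simps)
qed

lemma F_add: "u \<in> F n \<Longrightarrow> v \<in> F n \<Longrightarrow> u \<oplus> v \<in> F n"
proof (induction n arbitrary: u v)
  case 0 then show ?case by (auto simp flip: \<iota>.hom_add)
next
  case (Suc n)
  obtain r s w where u: "r \<in> carrier R" "s \<in> carrier R" "w \<in> F n"
    "u = (\<iota> r \<otimes> X (Suc n) \<oplus> \<iota> s \<otimes> Y (Suc n)) \<oplus> w" using Suc.prems(1) by (rule F_memE)
  obtain r' s' w' where v: "r' \<in> carrier R" "s' \<in> carrier R" "w' \<in> F n"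
    "v = (\<iota> r' \<otimes> X (Suc n) \<oplus> \<iota> s' \<otimes> Y (Suc n)) \<oplus> w'" using Suc.prems(2) by (rule F_memE)
  have "(\<iota> (r \<oplus>\<^bsub>R\<^esub> r') \<otimes> X (Suc n) \<oplus> \<iota> (s \<oplus>\<^bsub>R\<^esub> s') \<otimes> Y (Suc n)) \<oplus> (w \<oplus> w') \<in> F (Suc n)"
    using u v Suc.IH by (intro F_memI) auto
  also have "(\<iota> (r \<oplus>\<^bsub>R\<^esub> r') \<otimes> X (Suc n) \<oplus> \<iota> (s \<oplus>\<^bsub>R\<^esub> s') \<otimes> Y (Suc n)) \<oplus> (w \<oplus> w') = u \<oplus> v"
    using u(1-3) v(1-3) unfolding u(4) v(4)
    by (simp add: F_sub Q.l_distr Q.add.m_ac del: alt_word.simps)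
  finally show ?case .
qed

lemma F_scal: "r \<in> carrier R \<Longrightarrow> v \<in> F n \<Longrightarrow> \<iota> r \<otimes> v \<in> F n"
proof (induction n arbitrary: v)
  case 0 then show ?case by (auto simp flip: \<iota>.hom_mult)
next
  case (Suc n)
  obtain p s w where u: "p \<in> carrier R" "s \<in> carrier R" "w \<in> F n"
    "v = (\<iota> p \<otimes> X (Suc n) \<oplus> \<iota> s \<otimes> Y (Suc n)) \<oplus> w" using Suc.prems(2) by (rule F_memE)
  have "(\<iota> (r \<otimes>\<^bsub>R\<^esub> p) \<otimes> X (Suc n) \<oplus> \<iota> (r \<otimes>\<^bsub>R\<^esub> s) \<otimes> Y (Suc n)) \<oplus> \<iota> r \<otimes> w \<in> F (Suc n)"
    using u Suc by (intro F_memI) auto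
  also have "(\<iota> (r \<otimes>\<^bsub>R\<^esub> p) \<otimes> X (Suc n) \<oplus> \<iota> (r \<otimes>\<^bsub>R\<^esub> s) \<otimes> Y (Suc n)) \<oplus> \<iota> r \<otimes> w = \<iota> r \<otimes> v"
    using u(1-3) Suc.prems(1) unfolding u(4)
    by (simp add: F_sub Q.r_distr Q.m_assoc del: alt_word.simps)
  finally show ?case .
qed

lemma F_mono: "v \<in> F n \<Longrightarrow> v \<in> F (Suc n)"
  using F_memI[OF R.zero_closed R.zero_closed, of v n] F_sub[of v n] by (simp del: alt_word.simps word_span.simps)

lemma word_mem_F: "X n \<in> F n" "Y n \<in> F n"
proof -
  show "X n \<in> F n"
  proof (cases n)
    case 0 then show ?thesis using \<iota>.hom_one R.one_closed by (metis alt_word.simps(1) image_eqI word_span.simps(1))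
  next
    case (Suc m)
    from F_memI[OF R.one_closed R.zero_closed F_zero] Suc show ?thesis
      by (simp del: alt_word.simps word_span.simps)
  qed
  show "Y n \<in> F n"
  proof (cases n)
    case 0 then show ?thesis using \<iota>.hom_one R.one_closed by (metis alt_word.simps(1) image_eqI word_span.simps(1))
  next
    case (Suc m)
    from F_memI[OF R.zero_closed R.one_closed F_zero] Suc show ?thesis
      by (simp del: alt_word.simps word_span.simps)
  qed
qed

lemma x_mult_scal:
  assumes "r \<in> carrier R" "w \<in> carrier Q"
  shows "x \<otimes> (\<iota> r \<otimes> w) = \<iota> (\<tau>1 r) \<otimes> (x \<otimes> w) \<oplus> \<iota> (\<delta>1 r) \<otimes> w"
  using assms by (simp add: Q.m_assoc[symmetric] x_comm Q.l_distr)

lemma x_mult_word: "x \<otimes> X n \<in> F (Suc n)" "x \<otimes> Y n \<in> F (Suc n)"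
proof -
  show Y: "x \<otimes> Y n \<in> F (Suc n)" for n
    using word_mem_F(1)[of "Suc n"] by simp
  show "x \<otimes> X n \<in> F (Suc n)"
  proof (cases n)
    case 0 then show ?thesis using Y[of 0] by simp
  next
    case (Suc m)
    have "x \<otimes> X n = \<iota> a \<otimes> X n \<oplus> \<iota> b \<otimes> Y m"
      using Suc consts1 by (simp add: Q.m_assoc[symmetric] x_square Q.l_distr)
    moreover have "Y m \<in> F n" "Y m \<in> F (Suc n)" using Suc word_mem_F(2) F_mono by blast+
    ultimately show ?thesis using word_mem_F(1) F_mono consts1 by (metis F_add F_scal)
  qed
qed

lemma x_mult_F: "v \<in> F n \<Longrightarrow> x \<otimes> v \<in> F (Suc n)"
proof (induction n arbitrary: v)
  case 0
  then obtain r where r: "r \<in> carrier R" "v = \<iota> r" by auto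
  then have "x \<otimes> v = \<iota> (\<tau>1 r) \<otimes> X (Suc 0) \<oplus> \<iota> (\<delta>1 r) \<otimes> X 0"
    by (simp add: x_comm)
  then show ?case using r word_mem_F F_mono by (simp only: F_add F_scal \<tau>1.hom_closed \<delta>1_closed)
next
  case (Suc n)
  obtain r s w where u: "r \<in> carrier R" "s \<in> carrier R" "w \<in> F n"
    "v = (\<iota> r \<otimes> X (Suc n) \<oplus> \<iota> s \<otimes> Y (Suc n)) \<oplus> w" using Suc.prems(1) by (rule F_memE)
  have "x \<otimes> v = (\<iota> (\<tau>1 r) \<otimes> (x \<otimes> X (Suc n)) \<oplus> \<iota> (\<delta>1 r) \<otimes> X (Suc n)) \<oplus>
     (\<iota> (\<tau>1 s) \<otimes> (x \<otimes> Y (Suc n)) \<oplus> \<iota> (\<delta>1 s) \<otimes> Y (Suc n)) \<oplus> x \<otimes> w"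
    using u(1-3) unfolding u(4) by (simp add: F_sub Q.r_distr x_mult_scal del: alt_word.simps)
  then show ?case using u x_mult_word word_mem_F F_mono Suc.IH
    by (simp only: F_add F_scal \<tau>1.hom_closed \<delta>1_closed)
qed

lemma y_mult_F: "v \<in> F n \<Longrightarrow> y \<otimes> v \<in> F (Suc n)"
  using alternating_ring.x_mult_F[OF swap] by (simp only: word_span_swap)

lemma F_le: "m \<le> n \<Longrightarrow> v \<in> F m \<Longrightarrow> v \<in> F n"
  by (induction n rule: dec_induct) (auto intro: F_mono simp del: word_span.simps)

lemma F_exhausts:
  assumes "q \<in> carrier Q" obtains n where "q \<in> F n"
proof -
  have "carrier Q \<subseteq> (\<Union>n. F n)"
  proof (rule generated)
    show "\<one> \<in> (\<Union>n. F n)" using word_mem_F(1)[of 0] by (intro UN_I[of 0]) auto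
    show "u \<oplus> v \<in> (\<Union>n. F n)" if "u \<in> (\<Union>n. F n)" "v \<in> (\<Union>n. F n)" for u v
    proof -
      from that obtain m n where "u \<in> F m" "v \<in> F n" by blast
      then have "u \<oplus> v \<in> F (max m n)" by (intro F_add F_le[of _ "max m n"]) auto
      then show ?thesis by blast
    qed
    show "(\<Union>n. F n) \<subseteq> carrier Q" using F_sub by auto
    show "\<iota> r \<otimes> v \<in> (\<Union>n. F n)" if "r \<in> carrier R" "v \<in> (\<Union>n. F n)" for r v
      using that F_scal by (metis UN_iff)
    show "x \<otimes> v \<in> (\<Union>n. F n)" "y \<otimes> v \<in> (\<Union>n. F n)" if "v \<in> (\<Union>n. F n)" for v
      using that x_mult_F y_mult_F by (metis UN_iff UNIV_I)+
  qed
  then show ?thesis using assms that by blast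
qed

subsection \<open>Leading coefficients\<close>

text \<open>Only the range \<open>\<bar>i\<bar> \<ge> n\<close> is described: below it the shorter words interfere. The range is
  nevertheless stable under prefixing a letter, since the coefficients of \<open>x \<otimes> q\<close> and \<open>y \<otimes> q\<close> at
  \<open>\<bar>i\<bar> \<ge> n + 1\<close> only involve those of \<open>q\<close> at indices of absolute value at least \<open>n\<close>.\<close>

lemma coef_word_scal:
  assumes r: "r \<in> carrier R" and "int n \<le> \<bar>i\<bar>"
  shows "coef (X n \<otimes> \<iota> r) i = (if i = int n then alt_comp n \<tau>1 \<tau>2 r else \<zero>\<^bsub>R\<^esub>)"
    and "coef (Y n \<otimes> \<iota> r) i = (if i = - int n then alt_comp n \<tau>2 \<tau>1 r else \<zero>\<^bsub>R\<^esub>)"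
proof -
  have "\<forall>i. int n \<le> \<bar>i\<bar> \<longrightarrow>
    coef (X n \<otimes> \<iota> r) i = (if i = int n then alt_comp n \<tau>1 \<tau>2 r else \<zero>\<^bsub>R\<^esub>) \<and>
    coef (Y n \<otimes> \<iota> r) i = (if i = - int n then alt_comp n \<tau>2 \<tau>1 r else \<zero>\<^bsub>R\<^esub>)"
  proof (induction n)
    case 0
    have "coef (\<iota> r) i = r \<otimes>\<^bsub>R\<^esub> coef \<one> i" for i using coef_scal[OF r Q.one_closed] r by simp
    then show ?case using r by (simp add: coef_one)
  next
    case (Suc n)
    have eq: "X (Suc n) \<otimes> \<iota> r = x \<otimes> (Y n \<otimes> \<iota> r)" "Y (Suc n) \<otimes> \<iota> r = y \<otimes> (X n \<otimes> \<iota> r)"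
      using r by (simp_all add: Q.m_assoc)
    have cl: "Y n \<otimes> \<iota> r \<in> carrier Q" "X n \<otimes> \<iota> r \<in> carrier Q" using r by simp_all
    show ?case
    proof (intro allI impI)
      fix i assume i: "int (Suc n) \<le> \<bar>i\<bar>"
      have X: "coef (X (Suc n) \<otimes> \<iota> r) i = (if i = int (Suc n) then alt_comp (Suc n) \<tau>1 \<tau>2 r else \<zero>\<^bsub>R\<^esub>)"
      proof (cases "1 \<le> i")
        case True
        then have "coef (Y n \<otimes> \<iota> r) i = \<zero>\<^bsub>R\<^esub>"
          "coef (Y n \<otimes> \<iota> r) (1 - i) = (if 1 - i = - int n then alt_comp n \<tau>2 \<tau>1 r else \<zero>\<^bsub>R\<^esub>)"
          using Suc.IH i by auto
        then show ?thesis unfolding eq using True consts1 r by (auto simp: coef_x_pos cl)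
      next
        case False
        then have "coef (Y n \<otimes> \<iota> r) i = \<zero>\<^bsub>R\<^esub>" "coef (Y n \<otimes> \<iota> r) (1 - i) = \<zero>\<^bsub>R\<^esub>"
          using Suc.IH i by auto
        then show ?thesis unfolding eq using False consts1 by (auto simp: coef_x_nonpos cl)
      qed
      have Y: "coef (Y (Suc n) \<otimes> \<iota> r) (- (- i)) = (if - i = int (Suc n) then alt_comp (Suc n) \<tau>2 \<tau>1 r else \<zero>\<^bsub>R\<^esub>)"
      proof (cases "1 \<le> - i")
        case True
        then have "coef (X n \<otimes> \<iota> r) (-(-i)) = \<zero>\<^bsub>R\<^esub>"
          "coef (X n \<otimes> \<iota> r) (- (1 - (- i))) = (if 1 - (- i) = - int n then alt_comp n \<tau>1 \<tau>2 r else \<zero>\<^bsub>R\<^esub>)"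
          using Suc.IH i by auto
        then show ?thesis unfolding eq coef_y_pos[OF cl(2) True] using consts2 r by auto
      next
        case False
        then have le: "- i \<le> 0" by simp
        then have "coef (X n \<otimes> \<iota> r) (-(-i)) = \<zero>\<^bsub>R\<^esub>" "coef (X n \<otimes> \<iota> r) (- (1 - (- i))) = \<zero>\<^bsub>R\<^esub>"
          using Suc.IH i False by auto
        then show ?thesis unfolding eq coef_y_nonpos[OF cl(2) le] using False consts2 by auto
      qed
      show "coef (X (Suc n) \<otimes> \<iota> r) i = (if i = int (Suc n) then alt_comp (Suc n) \<tau>1 \<tau>2 r else \<zero>\<^bsub>R\<^esub>) \<and>
        coef (Y (Suc n) \<otimes> \<iota> r) i = (if i = - int (Suc n) then alt_comp (Suc n) \<tau>2 \<tau>1 r else \<zero>\<^bsub>R\<^esub>)"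
        using X Y by auto
    qed
  qed
  then show "coef (X n \<otimes> \<iota> r) i = (if i = int n then alt_comp n \<tau>1 \<tau>2 r else \<zero>\<^bsub>R\<^esub>)"
    and "coef (Y n \<otimes> \<iota> r) i = (if i = - int n then alt_comp n \<tau>2 \<tau>1 r else \<zero>\<^bsub>R\<^esub>)"
    using assms by auto
qed

lemma alt_comp_one: "alt_comp n \<tau>1 \<tau>2 \<one>\<^bsub>R\<^esub> = \<one>\<^bsub>R\<^esub>" "alt_comp n \<tau>2 \<tau>1 \<one>\<^bsub>R\<^esub> = \<one>\<^bsub>R\<^esub>"
  by (induction n) (auto simp: ring_hom_one[OF hom1] ring_hom_one[OF hom2])

lemma coef_word:
  assumes "int n \<le> \<bar>i\<bar>"
  shows "coef (X n) i = (if i = int n then \<one>\<^bsub>R\<^esub> else \<zero>\<^bsub>R\<^esub>)"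
    and "coef (Y n) i = (if i = - int n then \<one>\<^bsub>R\<^esub> else \<zero>\<^bsub>R\<^esub>)"
  using coef_word_scal[OF R.one_closed assms] by (simp_all add: alt_comp_one)

lemma coef_outside: "v \<in> F n \<Longrightarrow> int n < \<bar>i\<bar> \<Longrightarrow> coef v i = \<zero>\<^bsub>R\<^esub>"
proof (induction n arbitrary: v)
  case 0
  then obtain r where r: "r \<in> carrier R" "v = \<iota> r \<otimes> \<one>" by auto
  then show ?case using 0 by (simp only: coef_scal Q.one_closed coef_one) auto
next
  case (Suc n)
  obtain r s w where u: "r \<in> carrier R" "s \<in> carrier R" "w \<in> F n"
    "v = (\<iota> r \<otimes> X (Suc n) \<oplus> \<iota> s \<otimes> Y (Suc n)) \<oplus> w" using Suc.prems(1) by (rule F_memE)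
  have "coef w i = \<zero>\<^bsub>R\<^esub>" "coef (X (Suc n)) i = \<zero>\<^bsub>R\<^esub>" "coef (Y (Suc n)) i = \<zero>\<^bsub>R\<^esub>"
    using Suc.IH[OF u(3)] Suc.prems(2) coef_word[of "Suc n" i] by auto
  then show ?case using u(1-3) unfolding u(4)
    by (simp add: coef_add coef_scal F_sub del: alt_word.simps)
qed

lemma F_decomp:
  assumes "v \<in> F (Suc n)"
  obtains w where "w \<in> F n"
    "v = (\<iota> (coef v (int (Suc n))) \<otimes> X (Suc n) \<oplus> \<iota> (coef v (- int (Suc n))) \<otimes> Y (Suc n)) \<oplus> w"
proof -
  obtain r s w where u: "r \<in> carrier R" "s \<in> carrier R" "w \<in> F n"
    "v = (\<iota> r \<otimes> X (Suc n) \<oplus> \<iota> s \<otimes> Y (Suc n)) \<oplus> w" using assms by (rule F_memE)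
  have "coef v i = r \<otimes>\<^bsub>R\<^esub> coef (X (Suc n)) i \<oplus>\<^bsub>R\<^esub> s \<otimes>\<^bsub>R\<^esub> coef (Y (Suc n)) i \<oplus>\<^bsub>R\<^esub> coef w i" for i
    using u(1-3) unfolding u(4) by (simp add: coef_add coef_scal F_sub del: alt_word.simps)
  then have "coef v (int (Suc n)) = r" "coef v (- int (Suc n)) = s"
    using u coef_outside[OF u(3)] by (simp_all add: coef_word del: alt_word.simps)
  then show ?thesis using that u by blast
qed

lemma F_drop:
  assumes "v \<in> F (Suc n)" "coef v (int (Suc n)) = \<zero>\<^bsub>R\<^esub>" "coef v (- int (Suc n)) = \<zero>\<^bsub>R\<^esub>"
  shows "v \<in> F n"
  by (rule F_decomp[OF assms(1)]) (use assms(2,3) F_sub in \<open>simp del: alt_word.simps word_span.simps\<close>)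

lemma word_scal_F:
  assumes "r \<in> carrier R" shows "X n \<otimes> \<iota> r \<in> F n" "Y n \<otimes> \<iota> r \<in> F n"
  using assms
proof (induction n)
  case (Suc n)
  case 1 with Suc show ?case using x_mult_F by (simp add: Q.m_assoc del: word_span.simps)
next
  case (Suc n)
  case 2 with Suc show ?case using y_mult_F by (simp add: Q.m_assoc del: word_span.simps)
qed auto

lemma F_right:
  assumes r: "r \<in> carrier R"
  shows "v \<in> F n \<Longrightarrow> v \<otimes> \<iota> r \<in> F n"
proof (induction n arbitrary: v)
  case 0 then show ?case using r by (auto simp flip: \<iota>.hom_mult)
next
  case (Suc n)
  obtain p s w where u: "p \<in> carrier R" "s \<in> carrier R" "w \<in> F n"
    "v = (\<iota> p \<otimes> X (Suc n) \<oplus> \<iota> s \<otimes> Y (Suc n)) \<oplus> w" using Suc.prems(1) by (rule F_memE)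
  have "v \<otimes> \<iota> r = (\<iota> p \<otimes> (X (Suc n) \<otimes> \<iota> r) \<oplus> \<iota> s \<otimes> (Y (Suc n) \<otimes> \<iota> r)) \<oplus> w \<otimes> \<iota> r"
    using u(1-3) r unfolding u(4) by (simp add: F_sub Q.l_distr Q.m_assoc del: alt_word.simps)
  then show ?case using u r word_scal_F F_mono[OF Suc.IH] by (simp only: F_add F_scal)
qed

lemma coef_right_leading:
  assumes r: "r \<in> carrier R" and v: "v \<in> F n"
  shows "coef (v \<otimes> \<iota> r) (int n) = coef v (int n) \<otimes>\<^bsub>R\<^esub> alt_comp n \<tau>1 \<tau>2 r"
    and "coef (v \<otimes> \<iota> r) (- int n) = coef v (- int n) \<otimes>\<^bsub>R\<^esub> alt_comp n \<tau>2 \<tau>1 r"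
proof -
  have "coef (v \<otimes> \<iota> r) (int n) = coef v (int n) \<otimes>\<^bsub>R\<^esub> alt_comp n \<tau>1 \<tau>2 r \<and>
     coef (v \<otimes> \<iota> r) (- int n) = coef v (- int n) \<otimes>\<^bsub>R\<^esub> alt_comp n \<tau>2 \<tau>1 r"
  proof (cases n)
    case 0
    then obtain s where s: "s \<in> carrier R" "v = \<iota> s" using v by auto
    have "coef (\<iota> t) 0 = t" if "t \<in> carrier R" for t
      using coef_scal[OF that Q.one_closed, of 0] that by (simp add: coef_one)
    then show ?thesis using 0 s r by (simp flip: \<iota>.hom_mult)
  next
    case (Suc m)
    obtain w where w: "w \<in> F m"
     "v = (\<iota> (coef v (int n)) \<otimes> X n \<oplus> \<iota> (coef v (- int n)) \<otimes> Y n) \<oplus> w"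
      using F_decomp v Suc by metis
    have vc: "coef v i \<in> carrier R" for i using F_sub[OF v] by simp
    have "v \<otimes> \<iota> r = (\<iota> (coef v (int n)) \<otimes> (X n \<otimes> \<iota> r) \<oplus> \<iota> (coef v (- int n)) \<otimes> (Y n \<otimes> \<iota> r)) \<oplus> w \<otimes> \<iota> r"
      by (subst w(2)) (use w(1) r vc in \<open>simp add: F_sub Q.l_distr Q.m_assoc\<close>)
    moreover have "coef (w \<otimes> \<iota> r) (int n) = \<zero>\<^bsub>R\<^esub>" "coef (w \<otimes> \<iota> r) (- int n) = \<zero>\<^bsub>R\<^esub>"
      using coef_outside[OF F_right[OF r w(1)]] Suc by auto
    ultimately show ?thesis
      using w(1) r vc Suc by (simp add: coef_add coef_scal coef_word_scal F_sub del: alt_word.simps alt_comp.simps)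
  qed
  then show "coef (v \<otimes> \<iota> r) (int n) = coef v (int n) \<otimes>\<^bsub>R\<^esub> alt_comp n \<tau>1 \<tau>2 r"
    and "coef (v \<otimes> \<iota> r) (- int n) = coef v (- int n) \<otimes>\<^bsub>R\<^esub> alt_comp n \<tau>2 \<tau>1 r" by auto
qed

text \<open>The one subleading coefficient that enters the argument. It is where \<open>\<delta>1\<close> becomes visible:
  dropping the first letter \<open>x\<close> of \<open>X (Suc n)\<close> leaves \<open>Y n\<close>, and no other way of moving \<open>r\<close> to the
  left contributes to \<open>Y n\<close>.\<close>

lemma coef_word_scal_sub:
  assumes r: "r \<in> carrier R"
  shows "coef (X (Suc n) \<otimes> \<iota> r) (- int n) = \<delta>1 (alt_comp n \<tau>2 \<tau>1 r)"
proof -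
  have "X (Suc n) \<otimes> \<iota> r = x \<otimes> (Y n \<otimes> \<iota> r)" using r by (simp add: Q.m_assoc)
  then show ?thesis using r consts1
    by (simp add: coef_x_nonpos coef_word_scal)
qed

section \<open>Two-sided ideals\<close>

lemma inverse_scalar:
  assumes "r \<in> carrier R" "r \<noteq> \<zero>\<^bsub>R\<^esub>"
  obtains s where "s \<in> carrier R" "s \<otimes>\<^bsub>R\<^esub> r = \<one>\<^bsub>R\<^esub>" "s \<noteq> \<zero>\<^bsub>R\<^esub>"
proof -
  have "r \<in> Units R" using assms R.Units_eq by blast
  then show ?thesis using that[of "inv\<^bsub>R\<^esub> r"] R.Units_inv_closed R.Units_l_inv R.Units_inv_Units R.Units_eq by blast
qed

lemma ideal_comb:
  assumes "ideal I Q" "u \<in> I" "v \<in> I" "r \<in> carrier R"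
  shows "u \<oplus> \<iota> r \<otimes> v \<in> I"
proof -
  interpret I: ideal I Q by fact
  show ?thesis using assms by (simp add: I.I_l_closed)
qed

text \<open>Suppose that \<open>f\<close> leads with \<open>X (Suc k)\<close> alone and normalise it to \<open>h = X (Suc k) \<oplus> g\<close>. The
  twisted commutators of \<open>h\<close> with scalars have no leading terms, so they vanish by minimality.
  Their coefficients at \<open>Y k\<close> say that \<open>\<delta>1 u = \<tau>1 u s - s u\<close>, where \<open>s\<close> is the coefficient of
  \<open>g\<close> at \<open>Y k\<close> and \<open>u\<close> ranges over all scalars because the twist of \<open>Y k\<close> is onto.\<close>

lemma one_sided_leading_zero:
  assumes I: "ideal I Q" and min: "I \<inter> F k \<subseteq> {\<zero>}"
    and f: "f \<in> I" "f \<in> F (Suc k)" "coef f (- int (Suc k)) = \<zero>\<^bsub>R\<^esub>"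
    and outer: "\<not> inner_twisted_derivation R \<tau>1 \<delta>1"
  shows "f = \<zero>"
proof (rule ccontr)
  interpret I: ideal I Q by fact
  assume "f \<noteq> \<zero>"
  then have "coef f (int (Suc k)) \<noteq> \<zero>\<^bsub>R\<^esub>" using F_drop f min by blast
  then obtain t where t: "t \<in> carrier R" "t \<otimes>\<^bsub>R\<^esub> coef f (int (Suc k)) = \<one>\<^bsub>R\<^esub>"
    using inverse_scalar coef_closed[OF F_sub[OF f(2)]] by metis
  define h where "h = \<iota> t \<otimes> f"
  have h: "h \<in> I" "h \<in> F (Suc k)" "coef h (int (Suc k)) = \<one>\<^bsub>R\<^esub>" "coef h (- int (Suc k)) = \<zero>\<^bsub>R\<^esub>"
    using f t I.I_l_closed F_scal F_sub[OF f(2)] unfolding h_def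
    by (simp_all add: coef_scal del: word_span.simps)
  obtain g where g: "g \<in> F k" "h = X (Suc k) \<oplus> g"
    by (rule F_decomp[OF h(2)]) (use h(3,4) F_sub in \<open>simp del: alt_word.simps word_span.simps of_nat_Suc\<close>)
  define s where "s = coef g (- int k)"
  have s: "s \<in> carrier R" unfolding s_def using F_sub[OF g(1)] by simp
  \<comment> \<open>\<open>X (Suc k)\<close> contributes \<open>\<delta>1 1 = 0\<close> at \<open>Y k\<close>.\<close>
  have hs: "coef h (- int k) = s"
    using coef_word_scal_sub[OF R.one_closed, of k] F_sub[OF g(1)] s
    unfolding g(2) s_def by (simp add: coef_add alt_comp_one)
  have "\<delta>1 u = \<tau>1 u \<otimes>\<^bsub>R\<^esub> s \<ominus>\<^bsub>R\<^esub> s \<otimes>\<^bsub>R\<^esub> u" if u: "u \<in> carrier R" for u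
  proof -
    obtain r where r: "r \<in> carrier R" "u = alt_comp k \<tau>2 \<tau>1 r"
      using alt_comp_image u by blast
    \<comment> \<open>The coefficient \<open>\<tau>1 u\<close> is the image of \<open>r\<close> under the twist of \<open>X (Suc k)\<close>.\<close>
    define e where "e = h \<otimes> \<iota> r \<oplus> \<iota> (\<ominus>\<^bsub>R\<^esub> \<tau>1 u) \<otimes> h"
    have hc: "h \<in> carrier Q" using F_sub h(2) by blast
    have e_coef: "coef e i = coef (h \<otimes> \<iota> r) i \<oplus>\<^bsub>R\<^esub> (\<ominus>\<^bsub>R\<^esub> \<tau>1 u) \<otimes>\<^bsub>R\<^esub> coef h i" for i
      unfolding e_def using hc r u by (simp add: coef_add coef_scal del: \<iota>.hom_a_inv)
    have "e \<in> I" unfolding e_def using h(1) u r by (intro ideal_comb[OF I]) (simp_all add: I.I_r_closed)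
    moreover have "e \<in> F k"
    proof (rule F_drop)
      show "e \<in> F (Suc k)" unfolding e_def using h u r by (intro F_add F_scal F_right) auto
      show "coef e (int (Suc k)) = \<zero>\<^bsub>R\<^esub>"
        using coef_right_leading(1)[OF r(1) h(2)] h(3) u r
        unfolding e_coef by (simp add: R.r_neg del: of_nat_Suc)
      show "coef e (- int (Suc k)) = \<zero>\<^bsub>R\<^esub>"
        using coef_right_leading(2)[OF r(1) h(2)] h(4) u r
        unfolding e_coef by (simp del: of_nat_Suc alt_comp.simps)
    qed
    ultimately have "e = \<zero>" using min by blast
    moreover have "coef \<zero> i = \<zero>\<^bsub>R\<^esub>" for i
      using coef_scal[OF R.zero_closed Q.one_closed] by (simp add: coef_one split: if_splits)
    moreover have "coef (h \<otimes> \<iota> r) (- int k) = \<delta>1 u \<oplus>\<^bsub>R\<^esub> s \<otimes>\<^bsub>R\<^esub> u"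
      unfolding g(2) using r F_sub[OF g(1)]
      by (simp add: Q.l_distr coef_add coef_word_scal_sub coef_right_leading(2)[OF r(1) g(1)] s_def
          del: alt_word.simps)
    ultimately have "(\<delta>1 u \<oplus>\<^bsub>R\<^esub> s \<otimes>\<^bsub>R\<^esub> u) \<oplus>\<^bsub>R\<^esub> (\<ominus>\<^bsub>R\<^esub> \<tau>1 u) \<otimes>\<^bsub>R\<^esub> s = \<zero>\<^bsub>R\<^esub>"
      using e_coef[of "- int k"] hs by simp
    then have "\<ominus>\<^bsub>R\<^esub> ((\<ominus>\<^bsub>R\<^esub> \<tau>1 u) \<otimes>\<^bsub>R\<^esub> s) = \<delta>1 u \<oplus>\<^bsub>R\<^esub> s \<otimes>\<^bsub>R\<^esub> u"
      using u s by (intro R.minus_equality) auto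
    then have "\<delta>1 u \<oplus>\<^bsub>R\<^esub> s \<otimes>\<^bsub>R\<^esub> u = \<tau>1 u \<otimes>\<^bsub>R\<^esub> s"
      using u s by (simp add: R.l_minus)
    then have "\<tau>1 u \<otimes>\<^bsub>R\<^esub> s \<ominus>\<^bsub>R\<^esub> s \<otimes>\<^bsub>R\<^esub> u = (\<delta>1 u \<oplus>\<^bsub>R\<^esub> s \<otimes>\<^bsub>R\<^esub> u) \<ominus>\<^bsub>R\<^esub> s \<otimes>\<^bsub>R\<^esub> u" by simp
    then show ?thesis using u s by (simp add: R.minus_eq R.a_assoc R.r_neg)
  qed
  then show False using outer der1 s unfolding inner_twisted_derivation_def by blast
qed

text \<open>Left multiplication by \<open>x\<close> forgets the leading coefficient at \<open>X m\<close>, because \<open>x \<otimes> X m\<close> is not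
  longer than \<open>X m\<close> for \<open>m > 0\<close>, and turns the one at \<open>Y m\<close> into a leading term at \<open>X (Suc m)\<close>
  alone. For \<open>m = 0\<close> the two words and their coefficients coincide.\<close>

lemma leading_transfer:
  assumes "ideal J Q" "p \<in> J" "p \<in> F m" "coef p (- int m) \<noteq> \<zero>\<^bsub>R\<^esub>"
  shows "\<exists>p\<in>J \<inter> F (Suc m). coef p (int (Suc m)) \<noteq> \<zero>\<^bsub>R\<^esub> \<and> coef p (- int (Suc m)) = \<zero>\<^bsub>R\<^esub>"
proof -
  interpret J: ideal J Q by fact
  have pc: "p \<in> carrier Q" using F_sub assms by blast
  have z: "coef p i = \<zero>\<^bsub>R\<^esub>" if "int m < \<bar>i\<bar>" for i using coef_outside[OF assms(3) that] .
  have "x \<otimes> p \<in> J \<inter> F (Suc m)" using assms x_mult_F J.I_l_closed by auto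
  moreover have "coef (x \<otimes> p) (int (Suc m)) = \<tau>1 (coef p (- int m))"
    using pc z[of "1 + int m"] consts1 by (simp add: coef_x_pos)
  moreover have "coef (x \<otimes> p) (- int (Suc m)) = \<zero>\<^bsub>R\<^esub>"
    using pc z[of "-1 - int m"] z[of "2 + int m"] consts1 by (simp add: coef_x_nonpos)
  moreover have "\<tau>1 (coef p (- int m)) \<noteq> \<zero>\<^bsub>R\<^esub>" using \<tau>1_eq_zero_iff assms(4) pc by simp
  ultimately show ?thesis by (intro bexI[of _ "x \<otimes> p"]) (simp_all del: of_nat_Suc)
qed

text \<open>A nonzero ideal is generated by any nonzero element \<open>f\<close> of it that lies in the lowest possible step of
  the filtration. Elements of the ideal in the same step are scalar multiples of \<open>f\<close>; in the higher
  steps the ideal generated by \<open>f\<close> contains elements with either leading term alone, which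
  allows both leading coefficients to be cancelled one at a time.\<close>

theorem ideal_principal:
  assumes I: "ideal I Q"
    and outer1: "\<not> inner_twisted_derivation R \<tau>1 \<delta>1" and outer2: "\<not> inner_twisted_derivation R \<tau>2 \<delta>2"
  shows "principalideal I Q"
proof (cases "I = {\<zero>}")
  case True
  then show ?thesis using Q.zeropideal by simp
next
  case False
  interpret I: ideal I Q by fact
  define low where "low n \<longleftrightarrow> (\<exists>f\<in>I \<inter> F n. f \<noteq> \<zero>)" for n
  obtain q where "q \<in> I" "q \<noteq> \<zero>" using False I.zero_closed by blast
  then have "\<exists>n. low n" unfolding low_def using F_exhausts I.Icarr by blast
  then obtain n where n: "low n" "\<And>m. m < n \<Longrightarrow> \<not> low m" using exists_least_iff[of low] by blast
  obtain f where f: "f \<in> I" "f \<in> F n" "f \<noteq> \<zero>" using n(1) unfolding low_def by blast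
  have fc: "f \<in> carrier Q" using F_sub f by blast
  \<comment> \<open>An element of minimal length is determined by either one of its leading coefficients.\<close>
  have lead_zero: "g = \<zero>" if g: "g \<in> I" "g \<in> F n" and "coef g (int n) = \<zero>\<^bsub>R\<^esub> \<or> coef g (- int n) = \<zero>\<^bsub>R\<^esub>" for g
  proof (cases n)
    case 0
    then obtain r where r: "r \<in> carrier R" "g = \<iota> r \<otimes> \<one>" using g(2) by auto
    then have "coef g 0 = r" by (simp only: coef_scal Q.one_closed coef_one) auto
    then show ?thesis using 0 that r by auto
  next
    case (Suc k)
    then have min: "I \<inter> F k \<subseteq> {\<zero>}" using n(2)[of k] unfolding low_def by blast
    then have min': "I \<inter> word_span Q R \<iota> y x k \<subseteq> {\<zero>}" unfolding word_span_swap .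
    have gF: "g \<in> F (Suc k)" "g \<in> word_span Q R \<iota> y x (Suc k)"
      using g(2) Suc by (simp_all only: word_span_swap)
    show ?thesis
      using that(3)
    proof
      assume "coef g (- int n) = \<zero>\<^bsub>R\<^esub>"
      then show ?thesis unfolding Suc by (rule one_sided_leading_zero[OF I min g(1) gF(1) _ outer1])
    next
      assume "coef g (int n) = \<zero>\<^bsub>R\<^esub>"
      then have "coef g (- (- int (Suc k))) = \<zero>\<^bsub>R\<^esub>" using Suc by (simp only: minus_minus)
      then show ?thesis by (rule alternating_ring.one_sided_leading_zero[OF swap I min' g(1) gF(2) _ outer2])
    qed
  qed
  have lead: "coef f (int n) \<noteq> \<zero>\<^bsub>R\<^esub>" "coef f (- int n) \<noteq> \<zero>\<^bsub>R\<^esub>" using lead_zero f by blast+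
  define J where "J = Idl {f}"
  have J: "ideal J Q" "f \<in> J" unfolding J_def using fc Q.genideal_ideal Q.genideal_self' by auto
  interpret J: ideal J Q by fact
  have cancel: "\<exists>r\<in>carrier R. coef g i \<oplus>\<^bsub>R\<^esub> r \<otimes>\<^bsub>R\<^esub> coef p i = \<zero>\<^bsub>R\<^esub>"
    if gp: "g \<in> carrier Q" "p \<in> carrier Q" "coef p i \<noteq> \<zero>\<^bsub>R\<^esub>" for g p i
  proof -
    obtain s where s: "s \<in> carrier R" "s \<otimes>\<^bsub>R\<^esub> coef p i = \<one>\<^bsub>R\<^esub>"
      using inverse_scalar gp coef_closed by metis
    have "coef g i \<oplus>\<^bsub>R\<^esub> (\<ominus>\<^bsub>R\<^esub> coef g i \<otimes>\<^bsub>R\<^esub> s) \<otimes>\<^bsub>R\<^esub> coef p i = \<zero>\<^bsub>R\<^esub>"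
      using gp s by (simp add: R.m_assoc R.r_neg R.l_minus)
    moreover have "\<ominus>\<^bsub>R\<^esub> coef g i \<otimes>\<^bsub>R\<^esub> s \<in> carrier R" using gp s by simp
    ultimately show ?thesis by blast
  qed
  have JI: "J \<subseteq> I" unfolding J_def using f I by (intro Q.genideal_minimal) auto
  have J_cancel: "g \<in> J" if "g \<oplus> \<iota> r \<otimes> p \<in> J" "p \<in> J" "g \<in> carrier Q" "r \<in> carrier R" for g r p
  proof -
    have "(g \<oplus> \<iota> r \<otimes> p) \<oplus> \<iota> (\<ominus>\<^bsub>R\<^esub> r) \<otimes> p \<in> J" using that by (intro ideal_comb[OF J(1) that(1)]) auto
    also have "(g \<oplus> \<iota> r \<otimes> p) \<oplus> \<iota> (\<ominus>\<^bsub>R\<^esub> r) \<otimes> p = g"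
      using that J.Icarr by (simp add: Q.a_assoc Q.l_minus Q.r_neg)
    finally show ?thesis .
  qed
  \<comment> \<open>Nonzero leading coefficients on both sides persist in all higher steps.\<close>
  have tops: "(\<exists>p\<in>J \<inter> F m. coef p (int m) \<noteq> \<zero>\<^bsub>R\<^esub>) \<and> (\<exists>p\<in>J \<inter> F m. coef p (- int m) \<noteq> \<zero>\<^bsub>R\<^esub>)"
    if "n \<le> m" for m using that
  proof (induction m rule: dec_induct)
    case base then show ?case using lead f J by blast
  next
    case (step m)
    then show ?case
      using leading_transfer[OF J(1), of _ m] alternating_ring.leading_transfer[OF swap J(1), of _ m]
      unfolding word_span_swap minus_minus by blast
  qed
  have "g \<in> J" if "n \<le> m" "g \<in> I" "g \<in> F m" for g m
    using that
  proof (induction m arbitrary: g rule: dec_induct)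
    case base
    have gc: "g \<in> carrier Q" using base F_sub by blast
    obtain r where r: "r \<in> carrier R" "coef g (int n) \<oplus>\<^bsub>R\<^esub> r \<otimes>\<^bsub>R\<^esub> coef f (int n) = \<zero>\<^bsub>R\<^esub>"
      using cancel[OF gc fc lead(1)] by blast
    have "g \<oplus> \<iota> r \<otimes> f = \<zero>"
      using base f r gc fc by (intro lead_zero ideal_comb[OF I] F_add F_scal) (auto simp: coef_add coef_scal)
    then show ?case using J_cancel J r gc by (metis J.zero_closed)
  next
    case (step m)
    have gc: "g \<in> carrier Q" using step F_sub by blast
    obtain p1 where p1: "p1 \<in> J" "p1 \<in> F (Suc m)" "coef p1 (int (Suc m)) \<noteq> \<zero>\<^bsub>R\<^esub>" "coef p1 (- int (Suc m)) = \<zero>\<^bsub>R\<^esub>"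
      using leading_transfer[OF J(1), of _ m] tops[OF step.hyps(1)] by blast
    obtain p2 where p2: "p2 \<in> J" "p2 \<in> F (Suc m)" "coef p2 (- int (Suc m)) \<noteq> \<zero>\<^bsub>R\<^esub>" "coef p2 (int (Suc m)) = \<zero>\<^bsub>R\<^esub>"
      using alternating_ring.leading_transfer[OF swap J(1), of _ m] tops[OF step.hyps(1)]
      unfolding word_span_swap minus_minus by blast
    have pc: "p1 \<in> carrier Q" "p2 \<in> carrier Q" using p1 p2 F_sub by blast+
    obtain r where r: "r \<in> carrier R" "coef g (int (Suc m)) \<oplus>\<^bsub>R\<^esub> r \<otimes>\<^bsub>R\<^esub> coef p1 (int (Suc m)) = \<zero>\<^bsub>R\<^esub>"
      using cancel[OF gc pc(1) p1(3)] by blast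
    obtain s where s: "s \<in> carrier R" "coef g (- int (Suc m)) \<oplus>\<^bsub>R\<^esub> s \<otimes>\<^bsub>R\<^esub> coef p2 (- int (Suc m)) = \<zero>\<^bsub>R\<^esub>"
      using cancel[OF gc pc(2) p2(3)] by blast
    define g' where "g' = (g \<oplus> \<iota> r \<otimes> p1) \<oplus> \<iota> s \<otimes> p2"
    have "coef g' i = (coef g i \<oplus>\<^bsub>R\<^esub> r \<otimes>\<^bsub>R\<^esub> coef p1 i) \<oplus>\<^bsub>R\<^esub> s \<otimes>\<^bsub>R\<^esub> coef p2 i" for i
      unfolding g'_def using gc pc r s by (simp add: coef_add coef_scal)
    then have drop: "coef g' (int (Suc m)) = \<zero>\<^bsub>R\<^esub>" "coef g' (- int (Suc m)) = \<zero>\<^bsub>R\<^esub>"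
      using r s p1(4) p2(4) gc by (simp_all del: of_nat_Suc)
    have "g' \<in> F (Suc m)"
      unfolding g'_def by (intro F_add F_scal step.prems r(1) s(1) p1(2) p2(2))
    then have low': "g' \<in> F m" using drop by (rule F_drop)
    have "p1 \<in> I" "p2 \<in> I" using p1(1) p2(1) JI by auto
    then have "g' \<in> I" unfolding g'_def by (intro ideal_comb[OF I] step.prems r(1) s(1))
    then have "g' \<in> J" using low' by (rule step.IH)
    moreover have "g \<oplus> \<iota> r \<otimes> p1 \<in> carrier Q" using gc pc(1) r(1) by (intro Q.a_closed Q.m_closed \<iota>.hom_closed)
    ultimately have "g \<oplus> \<iota> r \<otimes> p1 \<in> J" unfolding g'_def using J_cancel[OF _ p2(1) _ s(1)] by blast
    then show ?case by (rule J_cancel[OF _ p1(1) gc r(1)])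
  qed
  moreover have "\<exists>m\<ge>n. g \<in> F m" if g: "g \<in> I" for g
  proof -
    obtain m where "g \<in> F m" by (rule F_exhausts[OF I.Icarr[OF g]])
    then show ?thesis using F_le[of m "max m n"] by (intro exI[of _ "max m n"]) simp
  qed
  ultimately have "I \<subseteq> J" by blast
  then have "I = Idl {f}" using JI J_def by blast
  then show ?thesis using I fc by (intro principalidealI) auto
qed

end

section \<open>A quadratic extension acting on pairs of coordinates\<close>

definition quad_coords ::
    "('r, 'k) ring_scheme \<Rightarrow> ('a, 'm) ring_scheme \<Rightarrow> ('r \<Rightarrow> 'a) \<Rightarrow> 'a \<Rightarrow> 'a \<Rightarrow> 'r \<times> 'r" where
  "quad_coords R A \<iota> x u = (THE p. p \<in> carrier R \<times> carrier R \<and>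
     u = \<iota> (fst p) \<otimes>\<^bsub>A\<^esub> \<one>\<^bsub>A\<^esub> \<oplus>\<^bsub>A\<^esub> \<iota> (snd p) \<otimes>\<^bsub>A\<^esub> x)"

text \<open>A function \<open>m\<close> on the integers is read as a family of elements of the extension, one for each
  orbit \<open>{i, 1 - i}\<close>; the index \<open>i \<le> 0\<close> of an orbit carries the coefficient of \<open>1\<close> and the index
  \<open>1 - i\<close> that of \<open>x\<close>. The minimum and the maximum pick these two independently of the
  representative \<open>i\<close>. The action \<open>pair_act\<close> below is left multiplication on each of these elements.\<close>

definition pair_elem ::
    "('a, 'm) ring_scheme \<Rightarrow> ('r \<Rightarrow> 'a) \<Rightarrow> 'a \<Rightarrow> (int \<Rightarrow> 'r) \<Rightarrow> int \<Rightarrow> 'a" where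
  "pair_elem A \<iota> x m i = \<iota> (m (min i (1 - i))) \<oplus>\<^bsub>A\<^esub> \<iota> (m (max i (1 - i))) \<otimes>\<^bsub>A\<^esub> x"

definition pair_act ::
    "('r, 'k) ring_scheme \<Rightarrow> ('a, 'm) ring_scheme \<Rightarrow> ('r \<Rightarrow> 'a) \<Rightarrow> 'a \<Rightarrow> 'a \<Rightarrow> (int \<Rightarrow> 'r) \<Rightarrow> int \<Rightarrow> 'r" where
  "pair_act R A \<iota> x q m i =
     (if i \<le> 0 then fst else snd) (quad_coords R A \<iota> x (q \<otimes>\<^bsub>A\<^esub> pair_elem A \<iota> x m i))"

locale quadratic_data =
  fixes R :: "('r, 'k) ring_scheme" and A :: "('a, 'm) ring_scheme"
    and \<iota> :: "'r \<Rightarrow> 'a" and x :: 'a and \<tau> \<delta> :: "'r \<Rightarrow> 'r" and a b :: 'r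
  assumes data: "quadratic_extension_data R A \<iota> x \<tau> \<delta> a b"
begin

sublocale R: ring R
  using data by (simp add: quadratic_extension_data_def quadratic_extension_def)
sublocale A: ring A
  using data by (simp add: quadratic_extension_data_def quadratic_extension_def)

lemma emb_hom: "\<iota> \<in> ring_hom R A"
  using data by (simp add: quadratic_extension_data_def quadratic_extension_def)

sublocale \<iota>: ring_hom_ring R A \<iota>
  by (intro ring_hom_ringI2 R.ring_axioms A.ring_axioms emb_hom)

lemma gen_closed [simp]: "x \<in> carrier A"
  and twist_hom: "\<tau> \<in> ring_hom R R" and derivation: "twisted_derivation R \<tau> \<delta>"
  and const_closed [simp]: "a \<in> carrier R" "b \<in> carrier R"
  and gen_comm: "r \<in> carrier R \<Longrightarrow> x \<otimes>\<^bsub>A\<^esub> \<iota> r = \<iota> (\<tau> r) \<otimes>\<^bsub>A\<^esub> x \<oplus>\<^bsub>A\<^esub> \<iota> (\<delta> r)"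
  and gen_square: "x \<otimes>\<^bsub>A\<^esub> x = \<iota> a \<otimes>\<^bsub>A\<^esub> x \<oplus>\<^bsub>A\<^esub> \<iota> b"
  using data by (auto simp: quadratic_extension_data_def quadratic_extension_def)

lemma twist_closed [simp]: "r \<in> carrier R \<Longrightarrow> \<tau> r \<in> carrier R"
  and der_closed [simp]: "r \<in> carrier R \<Longrightarrow> \<delta> r \<in> carrier R"
  using ring_hom_closed[OF twist_hom] derivation by (auto simp: twisted_derivation_def)

abbreviation "co \<equiv> quad_coords R A \<iota> x"

lemma ex1_coords: "u \<in> carrier A \<Longrightarrow>
   \<exists>!p. p \<in> carrier R \<times> carrier R \<and> u = \<iota> (fst p) \<otimes>\<^bsub>A\<^esub> \<one>\<^bsub>A\<^esub> \<oplus>\<^bsub>A\<^esub> \<iota> (snd p) \<otimes>\<^bsub>A\<^esub> x"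
  using data by (simp add: quadratic_extension_data_def quadratic_extension_def)

lemma coords:
  assumes "u \<in> carrier A"
  shows "fst (co u) \<in> carrier R" "snd (co u) \<in> carrier R"
    "\<iota> (fst (co u)) \<oplus>\<^bsub>A\<^esub> \<iota> (snd (co u)) \<otimes>\<^bsub>A\<^esub> x = u"
proof -
  have c: "co u \<in> carrier R \<times> carrier R \<and>
      u = \<iota> (fst (co u)) \<otimes>\<^bsub>A\<^esub> \<one>\<^bsub>A\<^esub> \<oplus>\<^bsub>A\<^esub> \<iota> (snd (co u)) \<otimes>\<^bsub>A\<^esub> x"
    unfolding quad_coords_def by (rule theI'[OF ex1_coords[OF assms]])
  then show f: "fst (co u) \<in> carrier R" and s: "snd (co u) \<in> carrier R"
    by (simp_all add: mem_Times_iff)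
  show "\<iota> (fst (co u)) \<oplus>\<^bsub>A\<^esub> \<iota> (snd (co u)) \<otimes>\<^bsub>A\<^esub> x = u"
    using c f by simp
qed

lemma coords_eq:
  assumes "p \<in> carrier R" "q \<in> carrier R"
  shows "co (\<iota> p \<oplus>\<^bsub>A\<^esub> \<iota> q \<otimes>\<^bsub>A\<^esub> x) = (p, q)"
  unfolding quad_coords_def
  by (rule the1_equality[OF ex1_coords]) (use assms in auto)

lemma coords_add:
  assumes "u \<in> carrier A" "v \<in> carrier A"
  shows "co (u \<oplus>\<^bsub>A\<^esub> v) = (fst (co u) \<oplus>\<^bsub>R\<^esub> fst (co v), snd (co u) \<oplus>\<^bsub>R\<^esub> snd (co v))"
proof -
  note c = coords[OF assms(1)] coords[OF assms(2)]
  have "u \<oplus>\<^bsub>A\<^esub> v = (\<iota> (fst (co u)) \<oplus>\<^bsub>A\<^esub> \<iota> (snd (co u)) \<otimes>\<^bsub>A\<^esub> x) \<oplus>\<^bsub>A\<^esub> (\<iota> (fst (co v)) \<oplus>\<^bsub>A\<^esub> \<iota> (snd (co v)) \<otimes>\<^bsub>A\<^esub> x)"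
    by (simp only: c)
  also have "\<dots> = \<iota> (fst (co u) \<oplus>\<^bsub>R\<^esub> fst (co v)) \<oplus>\<^bsub>A\<^esub> \<iota> (snd (co u) \<oplus>\<^bsub>R\<^esub> snd (co v)) \<otimes>\<^bsub>A\<^esub> x"
    using c(1,2,4,5) by (simp add: A.l_distr A.add.m_ac)
  finally show ?thesis using c by (simp only: coords_eq R.a_closed)
qed

lemma coords_scal:
  assumes "r \<in> carrier R" "p \<in> carrier R" "q \<in> carrier R"
  shows "co (\<iota> r \<otimes>\<^bsub>A\<^esub> (\<iota> p \<oplus>\<^bsub>A\<^esub> \<iota> q \<otimes>\<^bsub>A\<^esub> x)) = (r \<otimes>\<^bsub>R\<^esub> p, r \<otimes>\<^bsub>R\<^esub> q)"
proof -
  have "\<iota> r \<otimes>\<^bsub>A\<^esub> (\<iota> p \<oplus>\<^bsub>A\<^esub> \<iota> q \<otimes>\<^bsub>A\<^esub> x) = \<iota> (r \<otimes>\<^bsub>R\<^esub> p) \<oplus>\<^bsub>A\<^esub> \<iota> (r \<otimes>\<^bsub>R\<^esub> q) \<otimes>\<^bsub>A\<^esub> x"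
    using assms by (simp add: A.r_distr A.m_assoc)
  then show ?thesis using assms by (simp only: coords_eq R.m_closed)
qed

lemma coords_gen:
  assumes "p \<in> carrier R" "q \<in> carrier R"
  shows "co (x \<otimes>\<^bsub>A\<^esub> (\<iota> p \<oplus>\<^bsub>A\<^esub> \<iota> q \<otimes>\<^bsub>A\<^esub> x)) =
    (\<delta> p \<oplus>\<^bsub>R\<^esub> \<tau> q \<otimes>\<^bsub>R\<^esub> b, \<tau> p \<oplus>\<^bsub>R\<^esub> \<tau> q \<otimes>\<^bsub>R\<^esub> a \<oplus>\<^bsub>R\<^esub> \<delta> q)"
proof -
  have "x \<otimes>\<^bsub>A\<^esub> (\<iota> p \<oplus>\<^bsub>A\<^esub> \<iota> q \<otimes>\<^bsub>A\<^esub> x) = x \<otimes>\<^bsub>A\<^esub> \<iota> p \<oplus>\<^bsub>A\<^esub> (x \<otimes>\<^bsub>A\<^esub> \<iota> q) \<otimes>\<^bsub>A\<^esub> x"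
    using assms by (simp add: A.r_distr A.m_assoc)
  also have "\<dots> = (\<iota> (\<tau> p) \<otimes>\<^bsub>A\<^esub> x \<oplus>\<^bsub>A\<^esub> \<iota> (\<delta> p)) \<oplus>\<^bsub>A\<^esub> (\<iota> (\<tau> q) \<otimes>\<^bsub>A\<^esub> (\<iota> a \<otimes>\<^bsub>A\<^esub> x \<oplus>\<^bsub>A\<^esub> \<iota> b) \<oplus>\<^bsub>A\<^esub> \<iota> (\<delta> q) \<otimes>\<^bsub>A\<^esub> x)"
    using assms by (simp add: gen_comm A.l_distr A.m_assoc gen_square)
  also have "\<dots> = \<iota> (\<delta> p \<oplus>\<^bsub>R\<^esub> \<tau> q \<otimes>\<^bsub>R\<^esub> b) \<oplus>\<^bsub>A\<^esub> \<iota> (\<tau> p \<oplus>\<^bsub>R\<^esub> \<tau> q \<otimes>\<^bsub>R\<^esub> a \<oplus>\<^bsub>R\<^esub> \<delta> q) \<otimes>\<^bsub>A\<^esub> x"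
    using assms by (simp add: A.l_distr A.r_distr A.m_assoc A.add.m_ac)
  finally show ?thesis using assms by (simp only: coords_eq R.m_closed R.a_closed twist_closed der_closed const_closed)
qed

abbreviation "pr \<equiv> pair_elem A \<iota> x"
abbreviation "act \<equiv> pair_act R A \<iota> x"
abbreviation "M \<equiv> UNIV \<rightarrow> carrier R"

lemma pair_elem_closed [simp]: "m \<in> M \<Longrightarrow> pr m i \<in> carrier A"
  by (simp add: pair_elem_def Pi_iff)

lemma pair_act_closed: "q \<in> carrier A \<Longrightarrow> m \<in> M \<Longrightarrow> act q m \<in> M"
  by (simp add: pair_act_def Pi_iff coords pair_elem_closed)

lemma pair_elem_min_max: "pr m (min i (1 - i)) = pr m i" "pr m (max i (1 - i)) = pr m i"
proof -
  have "2 * i \<noteq> 1" by presburger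
  then show "pr m (min i (1 - i)) = pr m i" "pr m (max i (1 - i)) = pr m i"
    by (simp_all add: pair_elem_def min_def max_def)
qed

text \<open>The reason why \<open>act\<close> is multiplicative: it corresponds to left multiplication in \<open>A\<close>.\<close>

lemma pair_elem_act: "q \<in> carrier A \<Longrightarrow> m \<in> M \<Longrightarrow> pr (act q m) i = q \<otimes>\<^bsub>A\<^esub> pr m i"
proof -
  assume qm: "q \<in> carrier A" "m \<in> M"
  have "act q m (min i (1 - i)) = fst (co (q \<otimes>\<^bsub>A\<^esub> pr m i))"
    "act q m (max i (1 - i)) = snd (co (q \<otimes>\<^bsub>A\<^esub> pr m i))"
    unfolding pair_act_def pair_elem_min_max by auto
  then show ?thesis unfolding pair_elem_def[of _ _ _ "act q m"]
    using qm by (simp add: coords)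
qed

lemma pair_act_mult: "p \<in> carrier A \<Longrightarrow> q \<in> carrier A \<Longrightarrow> m \<in> M \<Longrightarrow> act (p \<otimes>\<^bsub>A\<^esub> q) m = act p (act q m)"
  by (rule ext) (simp add: pair_act_def[of _ _ _ _ p] pair_act_def[of _ _ _ _ "p \<otimes>\<^bsub>A\<^esub> q"] pair_elem_act A.m_assoc)

lemma pair_act_add: "p \<in> carrier A \<Longrightarrow> q \<in> carrier A \<Longrightarrow> m \<in> M \<Longrightarrow>
    act (p \<oplus>\<^bsub>A\<^esub> q) m = (\<lambda>i. act p m i \<oplus>\<^bsub>R\<^esub> act q m i)"
  by (rule ext) (simp add: pair_act_def A.l_distr coords_add)

lemma pair_act_emb: "r \<in> carrier R \<Longrightarrow> m \<in> M \<Longrightarrow> act (\<iota> r) m = (\<lambda>i. r \<otimes>\<^bsub>R\<^esub> m i)"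
  by (rule ext) (simp add: pair_act_def pair_elem_def coords_scal Pi_iff min_def max_def)

lemma pair_act_one: "m \<in> M \<Longrightarrow> act \<one>\<^bsub>A\<^esub> m = m"
  using pair_act_emb[OF R.one_closed, of m] by (simp add: Pi_iff)

lemma pair_act_add_right:
  assumes "q \<in> carrier A" "m \<in> M" "m' \<in> M"
  shows "act q (\<lambda>i. m i \<oplus>\<^bsub>R\<^esub> m' i) = (\<lambda>i. act q m i \<oplus>\<^bsub>R\<^esub> act q m' i)"
proof
  fix i
  have mc: "m j \<in> carrier R" "m' j \<in> carrier R" for j using assms by auto
  have "pr (\<lambda>i. m i \<oplus>\<^bsub>R\<^esub> m' i) i = pr m i \<oplus>\<^bsub>A\<^esub> pr m' i"
    using mc by (simp add: pair_elem_def A.l_distr A.add.m_ac)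
  then show "act q (\<lambda>i. m i \<oplus>\<^bsub>R\<^esub> m' i) i = act q m i \<oplus>\<^bsub>R\<^esub> act q m' i"
    using assms by (simp add: pair_act_def A.r_distr coords_add)
qed

lemma pair_act_gen:
  assumes "m \<in> M"
  shows "1 \<le> i \<Longrightarrow> act x m i = \<tau> (m (1 - i)) \<oplus>\<^bsub>R\<^esub> \<tau> (m i) \<otimes>\<^bsub>R\<^esub> a \<oplus>\<^bsub>R\<^esub> \<delta> (m i)"
    and "i \<le> 0 \<Longrightarrow> act x m i = \<delta> (m i) \<oplus>\<^bsub>R\<^esub> \<tau> (m (1 - i)) \<otimes>\<^bsub>R\<^esub> b"
  using assms by (simp_all add: pair_act_def pair_elem_def coords_gen Pi_iff min_def max_def)

end

section \<open>Coordinates on the amalgamated product\<close>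

text \<open>The action on functions, defined on formal ring expressions before it is known to respect
  their congruence. The second extension acts through the reflection \<open>i \<mapsto> -i\<close>, so that its
  orbits are \<open>{i, -1 - i}\<close>; orbits of both kinds link all integers into one chain.\<close>

primrec term_act ::
    "('r, 'k) ring_scheme \<Rightarrow> ('a, 'm) ring_scheme \<Rightarrow> ('r \<Rightarrow> 'a) \<Rightarrow> 'a \<Rightarrow>
     ('b, 'n) ring_scheme \<Rightarrow> ('r \<Rightarrow> 'b) \<Rightarrow> 'b \<Rightarrow> ('a, 'b) ring_term \<Rightarrow> (int \<Rightarrow> 'r) \<Rightarrow> int \<Rightarrow> 'r" where
  "term_act R A f x B g y (In1 q) m = pair_act R A f x q m"
| "term_act R A f x B g y (In2 q) m = (\<lambda>i. pair_act R B g y q (\<lambda>j. m (- j)) (- i))"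
| "term_act R A f x B g y TZero m = (\<lambda>i. \<zero>\<^bsub>R\<^esub>)"
| "term_act R A f x B g y TOne m = m"
| "term_act R A f x B g y (TNeg s) m = (\<lambda>i. \<ominus>\<^bsub>R\<^esub> term_act R A f x B g y s m i)"
| "term_act R A f x B g y (TAdd s t) m =
     (\<lambda>i. term_act R A f x B g y s m i \<oplus>\<^bsub>R\<^esub> term_act R A f x B g y t m i)"
| "term_act R A f x B g y (TMul s t) m = term_act R A f x B g y s (term_act R A f x B g y t m)"

locale quadratic_amalgam =
  Q1: quadratic_data R A f x \<tau>1 \<delta>1 a b + Q2: quadratic_data R B g y \<tau>2 \<delta>2 c d
  for R :: "('r, 'k) ring_scheme" and A :: "('a, 'm) ring_scheme" and f x \<tau>1 \<delta>1 a b
    and B :: "('b, 'n) ring_scheme" and g y \<tau>2 \<delta>2 c d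
begin

sublocale ring_span R A B f g
  by unfold_locales (rule Q1.emb_hom Q2.emb_hom)+

abbreviation "act \<equiv> term_act R A f x B g y"
abbreviation "M \<equiv> UNIV \<rightarrow> carrier R"

lemma mirror_closed: "m \<in> M \<Longrightarrow> (\<lambda>i. m (- i)) \<in> M" for m :: "int \<Rightarrow> 'r"
  by auto

lemma act_closed: "s \<in> T \<Longrightarrow> m \<in> M \<Longrightarrow> act s m \<in> M"
proof (induction s arbitrary: m)
  case (In1 q) then show ?case using Q1.pair_act_closed by simp
next
  case (In2 q) then show ?case
    using Q2.pair_act_closed[of q "\<lambda>j. m (- j)"] by (simp add: Pi_iff)
next
  case (TMul s t) then show ?case by simp
qed (auto simp: Pi_iff)

lemma act_add_right:
  "s \<in> T \<Longrightarrow> m \<in> M \<Longrightarrow> m' \<in> M \<Longrightarrow>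
   act s (\<lambda>i. m i \<oplus>\<^bsub>R\<^esub> m' i) = (\<lambda>i. act s m i \<oplus>\<^bsub>R\<^esub> act s m' i)"
proof (induction s arbitrary: m m')
  case (In1 q) then show ?case by (simp add: Q1.pair_act_add_right)
next
  case (In2 q) then show ?case by (simp add: Q2.pair_act_add_right mirror_closed)
next
  case (TNeg s)
  then have "act s m i \<in> carrier R" "act s m' i \<in> carrier R" for i
    using act_closed by (auto simp: Pi_iff)
  then show ?case using TNeg by (simp add: Q1.R.minus_add)
next
  case (TAdd s t)
  then have "act s m i \<in> carrier R" "act s m' i \<in> carrier R"
    "act t m i \<in> carrier R" "act t m' i \<in> carrier R" for i
    using act_closed[of s] act_closed[of t] by (auto simp: Pi_iff)
  then show ?case using TAdd by (simp add: Q1.R.add.m_ac)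
next
  case (TMul s t) then show ?case using act_closed by simp
qed auto

text \<open>Amalgamation enters only through \<open>glue\<close>: both extensions let a scalar of \<open>R\<close> act by pointwise
  left multiplication, which is insensitive to the reflection.\<close>

lemma act_respects: "eqv s t \<Longrightarrow> m \<in> M \<Longrightarrow> act s m = act t m"
proof (induction arbitrary: m rule: amalg_eq.induct)
  case (mul_cong s s' t t') then show ?case using eqv_terms act_closed by simp
next
  case (add_assoc s t u) then show ?case
    using act_closed[of s m] act_closed[of t m] act_closed[of u m] by (simp add: Q1.R.add.m_assoc Pi_iff)
next
  case (add_comm s t) then show ?case
    using act_closed[of s m] act_closed[of t m] by (simp add: Q1.R.add.m_comm Pi_iff)
next
  case (add_zero s) then show ?case using act_closed[of s m] by (simp add: Pi_iff)
next
  case (add_neg s) then show ?case using act_closed[of s m] by (simp add: Q1.R.l_neg Pi_iff)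
next
  case (distrib_left s t u) then show ?case
    using act_closed[of s m] act_closed[of t m] by (simp add: act_add_right)
next
  case (in1_add p q) then show ?case by (simp add: Q1.pair_act_add)
next
  case (in1_mul p q) then show ?case by (simp add: Q1.pair_act_mult)
next
  case in1_one then show ?case by (simp add: Q1.pair_act_one)
next
  case (in2_add p q) then show ?case by (simp add: Q2.pair_act_add mirror_closed)
next
  case (in2_mul p q) then show ?case by (simp add: Q2.pair_act_mult mirror_closed)
next
  case in2_one then show ?case by (simp add: Q2.pair_act_one mirror_closed)
next
  case (glue r) then show ?case by (simp add: Q1.pair_act_emb Q2.pair_act_emb mirror_closed)
qed (simp_all add: act_closed)

definition basepoint :: "int \<Rightarrow> 'r" where
  "basepoint i = (if i = 0 then \<one>\<^bsub>R\<^esub> else \<zero>\<^bsub>R\<^esub>)"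

text \<open>The word of index \<open>i\<close> maps \<open>basepoint\<close> to the unit function at \<open>i\<close>, so the image of
  \<open>basepoint\<close> under an element is its list of coordinates. The choice of a representative is
  immaterial by \<open>act_respects\<close>.\<close>

definition coef :: "('a, 'b) ring_term set \<Rightarrow> int \<Rightarrow> 'r" where
  "coef X = act (SOME s. s \<in> X) basepoint"

lemma basepoint_closed: "basepoint \<in> M"
  by (simp add: basepoint_def Pi_iff)

lemma coef_cls:
  assumes "s \<in> T" shows "coef (cls s) = act s basepoint"
proof -
  have "s \<in> cls s" using assms by (auto simp: amalg_class_def intro: amalg_eq.refl)
  then have "(SOME t. t \<in> cls s) \<in> cls s" by (rule someI)
  then have "eqv s (SOME t. t \<in> cls s)" by (simp add: amalg_class_def)
  then show ?thesis unfolding coef_def using act_respects[OF _ basepoint_closed] by simp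
qed

lemma coef_in_M: "p \<in> carrier P \<Longrightarrow> coef p \<in> M"
  using act_closed[OF _ basepoint_closed] by (auto simp: carrier_P coef_cls Pi_iff)

lemma coef_left_mult:
  "p \<in> carrier P \<Longrightarrow> q \<in> carrier A \<Longrightarrow> coef (cls (In1 q) \<otimes>\<^bsub>P\<^esub> p) = pair_act R A f x q (coef p)"
  "p \<in> carrier P \<Longrightarrow> q' \<in> carrier B \<Longrightarrow> coef (cls (In2 q') \<otimes>\<^bsub>P\<^esub> p) =
     (\<lambda>i. pair_act R B g y q' (\<lambda>j. coef p (- j)) (- i))"
  by (auto simp: carrier_P mult_cls coef_cls)

lemma alternating_ring_amalgam:
  assumes skew: "skew_field R" and iso: "\<tau>1 \<in> ring_iso R R" "\<tau>2 \<in> ring_iso R R"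
  shows "alternating_ring P R (\<lambda>r. cls (In1 (f r))) (cls (In1 x)) (cls (In2 y)) coef
    \<tau>1 \<delta>1 a b \<tau>2 \<delta>2 c d"
proof -
  interpret P: ring P by (rule ring_amalgamated_product)
  interpret S: skew_field R by fact
  interpret h1: ring_hom_ring A P "\<lambda>q. cls (In1 q)"
    by (intro ring_hom_ringI2 Q1.A.ring_axioms P.ring_axioms amalg_in1_hom)
  interpret h2: ring_hom_ring B P "\<lambda>q. cls (In2 q)"
    by (intro ring_hom_ringI2 Q2.A.ring_axioms P.ring_axioms amalg_in2_hom)
  have glue: "cls (In1 (f r)) = cls (In2 (g r))" if "r \<in> carrier R" for r
    using that by (rule amalg_in_commute)
  show ?thesis
  proof (rule alternating_ring.intro[OF P.ring_axioms skew alternating_ring_axioms.intro])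
    show "(\<lambda>r. cls (In1 (f r))) \<in> ring_hom R P"
      using ring_hom_trans[OF Q1.emb_hom amalg_in1_hom] by (simp add: comp_def)
    show "cls (In1 x) \<in> carrier P" "cls (In2 y) \<in> carrier P" by simp_all
    show "\<tau>1 \<in> ring_iso R R" "\<tau>2 \<in> ring_iso R R" by fact+
    show "twisted_derivation R \<tau>1 \<delta>1" "twisted_derivation R \<tau>2 \<delta>2"
      by (rule Q1.derivation, rule Q2.derivation)
    show "a \<in> carrier R" "b \<in> carrier R" "c \<in> carrier R" "d \<in> carrier R" by simp_all
    fix r assume r: "r \<in> carrier R"
    show "cls (In1 x) \<otimes>\<^bsub>P\<^esub> cls (In1 (f r)) =
        cls (In1 (f (\<tau>1 r))) \<otimes>\<^bsub>P\<^esub> cls (In1 x) \<oplus>\<^bsub>P\<^esub> cls (In1 (f (\<delta>1 r)))"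
      using r by (simp flip: h1.hom_mult h1.hom_add add: Q1.gen_comm)
    show "cls (In2 y) \<otimes>\<^bsub>P\<^esub> cls (In1 (f r)) =
        cls (In1 (f (\<tau>2 r))) \<otimes>\<^bsub>P\<^esub> cls (In2 y) \<oplus>\<^bsub>P\<^esub> cls (In1 (f (\<delta>2 r)))"
      using r by (simp flip: h2.hom_mult h2.hom_add add: glue Q2.gen_comm)
    show "coef (cls (In1 (f r)) \<otimes>\<^bsub>P\<^esub> q) i = r \<otimes>\<^bsub>R\<^esub> coef q i" if "q \<in> carrier P" for q i
      using that r coef_in_M by (simp add: coef_left_mult Q1.pair_act_emb)
  next
    show "cls (In1 x) \<otimes>\<^bsub>P\<^esub> cls (In1 x) = cls (In1 (f a)) \<otimes>\<^bsub>P\<^esub> cls (In1 x) \<oplus>\<^bsub>P\<^esub> cls (In1 (f b))"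
      by (simp flip: h1.hom_mult h1.hom_add add: Q1.gen_square)
    show "cls (In2 y) \<otimes>\<^bsub>P\<^esub> cls (In2 y) = cls (In1 (f c)) \<otimes>\<^bsub>P\<^esub> cls (In2 y) \<oplus>\<^bsub>P\<^esub> cls (In1 (f d))"
      by (simp flip: h2.hom_mult h2.hom_add add: glue Q2.gen_square)
  next
    fix V assume V: "V \<subseteq> carrier P" "\<one>\<^bsub>P\<^esub> \<in> V" "\<And>u v. u \<in> V \<Longrightarrow> v \<in> V \<Longrightarrow> u \<oplus>\<^bsub>P\<^esub> v \<in> V"
      "\<And>r v. r \<in> carrier R \<Longrightarrow> v \<in> V \<Longrightarrow> cls (In1 (f r)) \<otimes>\<^bsub>P\<^esub> v \<in> V"
      "\<And>v. v \<in> V \<Longrightarrow> cls (In1 x) \<otimes>\<^bsub>P\<^esub> v \<in> V" "\<And>v. v \<in> V \<Longrightarrow> cls (In2 y) \<otimes>\<^bsub>P\<^esub> v \<in> V"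
    have neg: "\<ominus>\<^bsub>P\<^esub> v \<in> V" if v: "v \<in> V" for v
    proof -
      have "cls (In1 (f (\<ominus>\<^bsub>R\<^esub> \<one>\<^bsub>R\<^esub>))) \<otimes>\<^bsub>P\<^esub> v = \<ominus>\<^bsub>P\<^esub> v"
        using v V(1) by (simp add: P.l_minus subset_iff)
      then show ?thesis using V(4)[OF _ v, of "\<ominus>\<^bsub>R\<^esub> \<one>\<^bsub>R\<^esub>"] by simp
    qed
    \<comment> \<open>The elements that map \<open>V\<close> into itself by left multiplication form a subring that contains both
    extensions, hence everything.\<close>
    have "cls s \<otimes>\<^bsub>P\<^esub> v \<in> V" if "s \<in> T" "v \<in> V" for s v
      using that
    proof (induction s arbitrary: v)
      case (In1 q)
      then have q: "q \<in> carrier A" and v: "v \<in> carrier P" using V(1) by auto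
      note c = Q1.coords[OF q]
      have "cls (In1 q) \<otimes>\<^bsub>P\<^esub> v = cls (In1 (f (fst (Q1.co q)) \<oplus>\<^bsub>A\<^esub> f (snd (Q1.co q)) \<otimes>\<^bsub>A\<^esub> x)) \<otimes>\<^bsub>P\<^esub> v"
        by (simp only: c(3))
      also have "\<dots> = cls (In1 (f (fst (Q1.co q)))) \<otimes>\<^bsub>P\<^esub> v \<oplus>\<^bsub>P\<^esub> cls (In1 (f (snd (Q1.co q)))) \<otimes>\<^bsub>P\<^esub> (cls (In1 x) \<otimes>\<^bsub>P\<^esub> v)"
        using c(1,2) v by (simp add: P.l_distr P.m_assoc)
      finally show ?case using V(3-5) c In1.prems by simp
    next
      case (In2 q)
      then have q: "q \<in> carrier B" and v: "v \<in> carrier P" using V(1) by auto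
      note c = Q2.coords[OF q]
      have "cls (In2 q) \<otimes>\<^bsub>P\<^esub> v = cls (In2 (g (fst (Q2.co q)) \<oplus>\<^bsub>B\<^esub> g (snd (Q2.co q)) \<otimes>\<^bsub>B\<^esub> y)) \<otimes>\<^bsub>P\<^esub> v"
        by (simp only: c(3))
      also have "\<dots> = cls (In1 (f (fst (Q2.co q)))) \<otimes>\<^bsub>P\<^esub> v \<oplus>\<^bsub>P\<^esub> cls (In1 (f (snd (Q2.co q)))) \<otimes>\<^bsub>P\<^esub> (cls (In2 y) \<otimes>\<^bsub>P\<^esub> v)"
        using c(1,2) v by (simp add: glue P.l_distr P.m_assoc)
      finally show ?case using V(3,4,6) c In2.prems by simp
    next
      case TZero
      then have "v \<in> carrier P" using V(1) by auto
      then have "\<zero>\<^bsub>P\<^esub> \<otimes>\<^bsub>P\<^esub> v = v \<oplus>\<^bsub>P\<^esub> \<ominus>\<^bsub>P\<^esub> v" by (simp add: P.r_neg)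
      then show ?case using V(3) neg TZero by (simp add: zero_P)
    next
      case TOne
      then have "v \<in> carrier P" using V(1) by auto
      then have "\<one>\<^bsub>P\<^esub> \<otimes>\<^bsub>P\<^esub> v = v" by simp
      then show ?case using TOne by (simp add: one_P)
    next
      case (TNeg s)
      then have s: "cls s \<in> carrier P" "cls (TNeg s) \<in> carrier P" and v: "v \<in> carrier P"
        using V(1) by (auto simp: carrier_P)
      have "cls (TNeg s) \<oplus>\<^bsub>P\<^esub> cls s = \<zero>\<^bsub>P\<^esub>"
        using TNeg.prems by (simp add: add_cls zero_P) (rule cls_eqI, rule amalg_eq.add_neg)
      then have "\<ominus>\<^bsub>P\<^esub> cls s = cls (TNeg s)" using s by (intro P.minus_equality) auto
      then have "cls (TNeg s) \<otimes>\<^bsub>P\<^esub> v = \<ominus>\<^bsub>P\<^esub> (cls s \<otimes>\<^bsub>P\<^esub> v)"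
        using s v P.l_minus by metis
      then show ?case using neg TNeg by simp
    next
      case (TAdd s t)
      then have "cls s \<in> carrier P" "cls t \<in> carrier P" "v \<in> carrier P" using V(1) by (auto simp: carrier_P)
      then have "(cls s \<oplus>\<^bsub>P\<^esub> cls t) \<otimes>\<^bsub>P\<^esub> v = cls s \<otimes>\<^bsub>P\<^esub> v \<oplus>\<^bsub>P\<^esub> cls t \<otimes>\<^bsub>P\<^esub> v" by (rule P.l_distr)
      then show ?case using TAdd V(3) by (simp add: add_cls)
    next
      case (TMul s t)
      then have "cls s \<in> carrier P" "cls t \<in> carrier P" "v \<in> carrier P" using V(1) by (auto simp: carrier_P)
      then have "(cls s \<otimes>\<^bsub>P\<^esub> cls t) \<otimes>\<^bsub>P\<^esub> v = cls s \<otimes>\<^bsub>P\<^esub> (cls t \<otimes>\<^bsub>P\<^esub> v)" by (rule P.m_assoc)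
      then show ?case using TMul by (simp add: mult_cls)
    qed
    then have "p \<otimes>\<^bsub>P\<^esub> \<one>\<^bsub>P\<^esub> \<in> V" if "p \<in> carrier P" for p
      using that V(2) unfolding carrier_P by blast
    then show "carrier P \<subseteq> V" by auto
  next
    show "coef q i \<in> carrier R" if "q \<in> carrier P" for q i using coef_in_M[OF that] by auto
    show "coef \<one>\<^bsub>P\<^esub> i = (if i = 0 then \<one>\<^bsub>R\<^esub> else \<zero>\<^bsub>R\<^esub>)" for i
      by (simp add: one_P coef_cls basepoint_def)
    show "coef (p \<oplus>\<^bsub>P\<^esub> q) i = coef p i \<oplus>\<^bsub>R\<^esub> coef q i" if "p \<in> carrier P" "q \<in> carrier P" for p q i
      using that by (auto simp: carrier_P add_cls coef_cls)
    fix q i assume q: "q \<in> carrier P"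
    show "coef (cls (In1 x) \<otimes>\<^bsub>P\<^esub> q) i =
        \<tau>1 (coef q (1 - i)) \<oplus>\<^bsub>R\<^esub> \<tau>1 (coef q i) \<otimes>\<^bsub>R\<^esub> a \<oplus>\<^bsub>R\<^esub> \<delta>1 (coef q i)" if "1 \<le> i"
      using q that coef_in_M by (simp add: coef_left_mult Q1.pair_act_gen)
    show "coef (cls (In1 x) \<otimes>\<^bsub>P\<^esub> q) i = \<delta>1 (coef q i) \<oplus>\<^bsub>R\<^esub> \<tau>1 (coef q (1 - i)) \<otimes>\<^bsub>R\<^esub> b" if "i \<le> 0"
      using q that coef_in_M by (simp add: coef_left_mult Q1.pair_act_gen)
    show "coef (cls (In2 y) \<otimes>\<^bsub>P\<^esub> q) (- i) =
        \<tau>2 (coef q (- (1 - i))) \<oplus>\<^bsub>R\<^esub> \<tau>2 (coef q (- i)) \<otimes>\<^bsub>R\<^esub> c \<oplus>\<^bsub>R\<^esub> \<delta>2 (coef q (- i))" if "1 \<le> i"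
      using q that mirror_closed[OF coef_in_M[OF q]] by (simp add: coef_left_mult Q2.pair_act_gen)
    show "coef (cls (In2 y) \<otimes>\<^bsub>P\<^esub> q) (- i) = \<delta>2 (coef q (- i)) \<oplus>\<^bsub>R\<^esub> \<tau>2 (coef q (- (1 - i))) \<otimes>\<^bsub>R\<^esub> d" if "i \<le> 0"
      using q that mirror_closed[OF coef_in_M[OF q]] by (simp add: coef_left_mult Q2.pair_act_gen)
  qed
qed

end

section \<open>Principality of the amalgamated product\<close>

theorem theorem1p5:
  fixes R :: "('r, 'k) ring_scheme"
    and Q1 :: "('a, 'm) ring_scheme" and Q2 :: "('b, 'n) ring_scheme"
    and \<iota>1 :: "'r \<Rightarrow> 'a" and \<iota>2 :: "'r \<Rightarrow> 'b"
    and x :: 'a and y :: 'b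
    and \<tau>1 \<delta>1 \<tau>2 \<delta>2 :: "'r \<Rightarrow> 'r"
    and a b c d :: 'r
  assumes "skew_field R"
    and "quadratic_extension_data R Q1 \<iota>1 x \<tau>1 \<delta>1 a b"
    and "quadratic_extension_data R Q2 \<iota>2 y \<tau>2 \<delta>2 c d"
    and "\<tau>1 \<in> ring_iso R R"
    and "\<tau>2 \<in> ring_iso R R"
    and "\<not> inner_twisted_derivation R \<tau>1 \<delta>1"
    and "\<not> inner_twisted_derivation R \<tau>2 \<delta>2"
  shows "principal_ideal_ring (amalgamated_product R Q1 \<iota>1 Q2 \<iota>2)"
proof -
  interpret am: quadratic_amalgam R Q1 \<iota>1 x \<tau>1 \<delta>1 a b Q2 \<iota>2 y \<tau>2 \<delta>2 c d
    by (intro quadratic_amalgam.intro quadratic_data.intro) fact+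
  interpret alt: alternating_ring "amalgamated_product R Q1 \<iota>1 Q2 \<iota>2" R "\<lambda>r. am.cls (In1 (\<iota>1 r))"
      "am.cls (In1 x)" "am.cls (In2 y)" am.coef \<tau>1 \<delta>1 a b \<tau>2 \<delta>2 c d
    using assms(1,4,5) by (rule am.alternating_ring_amalgam)
  show ?thesis
    by (intro principal_ideal_ring.intro principal_ideal_ring_axioms.intro
        am.ring_amalgamated_product alt.ideal_principal assms(6,7))
qed

end
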